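(* Let $a>0$, $\nu\ge-\tfrac12$, and $z\in\mathbb{C}\setminus(-\infty,0]$. Then $$\int_{2a}^\infty \frac{J_\nu(bz)}{\sqrt{b^2-4a^2}}\,db=-\frac{\pi}{2}\,J_{\nu/2}(az)\,Y_{\nu/2}(az).$$
   Context: $J_\nu$ and $Y_\nu$, both defined on $\mathbb{C}\setminus(-\infty,0]$, are the Bessel functions of the first and second kind of order $\nu$.
   Formalization: For non-real z the integral over real b diverges, since J_ν(bz) grows like exp(b|Im z|); the literal identity is proved for z > 0, and for all z the path from 2a runs in the direction conj(z)/|z| with the root √(b²−4a²) continued along it. *)

theory Defs
  imports "HOL-Analysis.Analysis"
begin

definition bessel_J :: "complex \<Rightarrow> complex \<Rightarrow> complex" where
  "bessel_J \<nu> z =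
     (z / 2) powr \<nu> *
     (\<Sum>k. (- 1) ^ k * (z / 2) ^ (2 * k) * rGamma (\<nu> + of_nat k + 1) / fact k)"

text \<open>
  For integer order the quotient below has the form \<open>0 / 0\<close>; its singularity is
  removable, and \<open>Y\<close> is then the limit of the quotient as the order tends to that integer.
\<close>
definition bessel_Y :: "complex \<Rightarrow> complex \<Rightarrow> complex" where
  "bessel_Y \<nu> z =
     (let Q = (\<lambda>\<mu>. (bessel_J \<mu> z * cos (\<mu> * of_real pi) - bessel_J (- \<mu>) z) / sin (\<mu> * of_real pi))
      in if \<nu> \<in> \<int> then Lim (at \<nu>) Q else Q \<nu>)"

text \<open>
  The integral of \<open>f\<close> from \<open>p\<close> to infinity along the ray \<open>p + t * d\<close>, where \<open>t \<ge> 0\<close> and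
  \<open>d\<close> has modulus one. For \<open>d = 1\<close> and real \<open>p\<close> this is the integral of \<open>f\<close> over the
  real half-line \<open>{p..}\<close>.
\<close>
definition has_ray_integral ::
    "(complex \<Rightarrow> complex) \<Rightarrow> complex \<Rightarrow> complex \<Rightarrow> complex \<Rightarrow> bool" where
  "has_ray_integral f I p d \<longleftrightarrow>
     ((\<lambda>t::real. f (p + of_real t * d) * d) has_integral I) {0..}"

text \<open>
  For real \<open>c > 0\<close> this is the branch of the square root of \<open>b\<^sup>2 - c\<^sup>2\<close> that is positive for
  real \<open>b > c\<close> and analytic off the half-line from \<open>c\<close> to minus infinity. The principal
  root of \<open>b\<^sup>2 - c\<^sup>2\<close> jumps on the imaginary axis.
\<close>
definition sqrt_diff_squares :: "complex \<Rightarrow> complex \<Rightarrow> complex" where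
  "sqrt_diff_squares b c = csqrt (b - c) * csqrt (b + c)"

end

theory Submission
  imports Defs "HOL-Complex_Analysis.Complex_Analysis"
begin

text \<open>
  Let \<open>K\<^sub>\<nu>(x)\<close> be half the integral of \<open>exp (- x cosh t - \<nu> t)\<close> over the real line. For \<open>Re x > 0\<close>,
  writing \<open>K\<^sub>\<mu>(x)\<^sup>2\<close> as a double integral and rotating the variables to \<open>p + q\<close> and \<open>p - q\<close> turns it into the
  integral of \<open>K\<^sub>2\<^sub>\<mu>(2 x cosh q)\<close> over real \<open>q\<close>. For \<open>0 < \<nu> < 1\<close> a uniform bound
  \<open>K\<^sub>\<nu>(x) = O(|x| powr (-1/2))\<close> carries this identity to the imaginary axis. There \<open>J\<^sub>\<nu>(c)\<close> is a
  combination of \<open>K\<^sub>\<nu>(i c)\<close> and \<open>K\<^sub>\<nu>(- i c)\<close>, and the squares combine to the product \<open>J Y\<close>: this is the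
  claim for positive \<open>z\<close>. Multiplied by \<open>sin (\<pi> \<nu> / 2)\<close>, both sides, as functions of \<open>c = 2 a z\<close> and
  \<open>\<nu>\<close>, are holomorphic in each variable on the slit plane and on \<open>\<complex>\<close>, respectively, so the identity
  extends by analytic continuation; even integer \<open>\<nu>\<close> follow by passing to the limit that defines \<open>Y\<close>.
\<close>

section \<open>Holomorphic parameter integrals\<close>

text \<open>For non-real \<open>z\<close> the function \<open>J\<close> grows exponentially along
  real \<open>b\<close>, and the integral over the real half-line does not converge. The direction
  \<open>sgn (cnj z)\<close> is the one in which \<open>b z = 2 a z + |z| t\<close> moves
  horizontally: the imaginary part stays fixed and \<open>J\<close> remains O(t powr (-1/2)). In
  terms of \<open>c = 2 a z\<close> the real and the slanted integral are one function,
  \<open>ray_integral\<close>. On the imaginary axis the integral for \<open>K\<close> no longer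
  converges absolutely, so its bound has to come from oscillation. That argument needs 0 \<le> \<nu>
  \<le> 1, and the connection formula needs a Wronskian constant at both \<nu> and -\<nu>, each
  above -1 and nonzero; hence the range 0 < \<nu> < 1. Leaving this range requires a different
  estimate, for \<open>J\<close> itself and locally uniform in a complex order and in the starting
  point of the ray: the energy inequality supplies it, and with it the integrable majorants behind
  holomorphy in each variable.\<close>

lemma DERIV_parameter_integral:
  fixes f :: "complex \<Rightarrow> 'a \<Rightarrow> complex"
  assumes z: "z \<in> U" and "open U"
    and meas: "\<And>w. w \<in> U \<Longrightarrow> f w \<in> borel_measurable M"
    and holo: "\<And>t. t \<in> space M \<Longrightarrow> (\<lambda>w. f w t) holomorphic_on U"
    and h: "integrable M h" and dom: "\<And>w t. w \<in> U \<Longrightarrow> t \<in> space M \<Longrightarrow> norm (f w t) \<le> h t"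
  shows "((\<lambda>w. \<integral>t. f w t \<partial>M) has_field_derivative (\<integral>t. deriv (\<lambda>w. f w t) z \<partial>M)) (at z)"
proof -
  from \<open>open U\<close> z obtain r where r: "r > 0" "ball z r \<subseteq> U" by (meson open_contains_ball)
  have int: "integrable M (f w)" if "w \<in> U" for w
    by (rule Bochner_Integration.integrable_bound[OF h meas[OF that]])
       (use dom[OF that] in \<open>force intro!: AE_I2\<close>)
  have der: "((\<lambda>w. f w t) has_field_derivative deriv (\<lambda>w. f w t) w) (at w)"
    if "t \<in> space M" "w \<in> U" for w t
    using holo[OF that(1)] \<open>open U\<close> that(2) by (rule holomorphic_derivI)
  \<comment> \<open>A majorant of \<open>f\<close> alone is enough: Cauchy's estimate on discs of
    radius \<open>r/4\<close> turns it into the bound \<open>(4 / r) * h\<close> for the derivative,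
    and by the mean value inequality for the difference quotients.\<close>
  have bound: "norm (deriv (\<lambda>w. f w t) w) \<le> (4 / r) * h t" if t: "t \<in> space M" and w: "w \<in> ball z (r/2)" for t w
  proof -
    have sub: "cball w (r/4) \<subseteq> U"
    proof
      fix y assume "y \<in> cball w (r/4)"
      then have "dist z y < r" using w r(1) dist_triangle[of z y w] by (auto simp: dist_commute)
      then show "y \<in> U" using r(2) by auto
    qed
    have "norm ((deriv ^^ 1) (\<lambda>w. f w t) w) \<le> fact 1 * h t / (r/4) ^ 1"
    proof (rule Cauchy_inequality)
      show "(\<lambda>w. f w t) holomorphic_on ball w (r/4)"
        by (rule holomorphic_on_subset[OF holo[OF t]]) (use sub in auto)
      show "continuous_on (cball w (r / 4)) (\<lambda>w. f w t)"
        by (rule holomorphic_on_imp_continuous_on, rule holomorphic_on_subset[OF holo[OF t] sub])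
      show "norm (f x t) \<le> h t" if "norm (w - x) = r / 4" for x
        by (rule dom[OF _ t]) (use sub that in \<open>auto simp: dist_norm\<close>)
    qed (use r in auto)
    then show ?thesis by (simp add: field_simps)
  qed
  have ball_r2: "ball z (r/2) \<subseteq> U" using r subset_ball[of "r/2" r z] by simp
  define q where "q w t = (f w t - f z t) / (w - z)" for w t
  have qbound: "norm (q w t) \<le> (4 / r) * h t" if t: "t \<in> space M" and w: "w \<in> ball z (r/2)" "w \<noteq> z" for t w
  proof -
    have "norm (f w t - f z t) \<le> ((4 / r) * h t) * norm (w - z)"
    proof (rule field_differentiable_bound[of "ball z (r/2)" _ "deriv (\<lambda>w. f w t)"])
      fix y assume "y \<in> ball z (r/2)"
      then show "((\<lambda>w. f w t) has_field_derivative deriv (\<lambda>w. f w t) y) (at y within ball z (r/2))"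
        using der[OF t, of y] ball_r2 by (blast intro: has_field_derivative_at_within)
    qed (use bound[OF t] w r(1) in \<open>simp_all\<close>)
    then show ?thesis using w r(1) by (simp add: q_def norm_divide divide_simps)
  qed
  \<comment> \<open>Dominated convergence works along sequences. Dropping the first \<open>N\<close>
    terms puts every point into the half-size disc where the quotients are dominated.\<close>
  have lim: "(\<lambda>n. \<integral>t. q (X n) t \<partial>M) \<longlonglongrightarrow> (\<integral>t. deriv (\<lambda>w. f w t) z \<partial>M)"
    if X: "\<And>n. X n \<noteq> z" "X \<longlonglongrightarrow> z" for X
  proof -
    have "eventually (\<lambda>n. X n \<in> ball z (r/2)) sequentially"
      using tendstoD[OF X(2), of "r/2"] r(1) by (simp add: dist_commute)
    then obtain N where N: "\<And>n. n \<ge> N \<Longrightarrow> X n \<in> ball z (r/2)" by (auto simp: eventually_sequentially)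
    have X': "X (n + N) \<in> U" for n using N[of "n + N"] r by auto
    have ptw: "(\<lambda>n. q (X (n + N)) t) \<longlonglongrightarrow> deriv (\<lambda>w. f w t) z" if "t \<in> space M" for t
    proof -
      have "(\<lambda>w. q w t) \<midarrow>z\<rightarrow> deriv (\<lambda>w. f w t) z"
        using der[OF that z] by (simp add: q_def has_field_derivative_iff)
      moreover have "filterlim (\<lambda>n. X (n + N)) (at z) sequentially"
        using X LIMSEQ_ignore_initial_segment[OF X(2), of N] by (simp add: filterlim_at)
      ultimately show ?thesis by (rule filterlim_compose)
    qed
    have qm: "(\<lambda>t. q (X (n + N)) t) \<in> borel_measurable M" for n
      unfolding q_def using meas[OF X'[of n]] meas[OF z] by auto
    have dm: "(\<lambda>t. deriv (\<lambda>w. f w t) z) \<in> borel_measurable M"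
      by (rule borel_measurable_LIMSEQ_metric[OF qm ptw])
    have ae: "AE t in M. (\<lambda>n. q (X (n + N)) t) \<longlonglongrightarrow> deriv (\<lambda>w. f w t) z" using ptw by auto
    have bd: "AE t in M. norm (q (X (n + N)) t) \<le> (4 / r) * h t" for n
      using qbound N[of "n + N"] X(1) by (intro AE_I2) auto
    have hi: "integrable M (\<lambda>t. (4 / r) * h t)" using h by simp
    show ?thesis
      using integral_dominated_convergence[OF dm qm hi ae bd]
        LIMSEQ_offset[of "\<lambda>n. \<integral>t. q (X n) t \<partial>M" N] by simp
  qed
  have quot: "(\<integral>t. q w t \<partial>M) = ((\<integral>t. f w t \<partial>M) - (\<integral>t. f z t \<partial>M)) / (w - z)" if "w \<in> U" for w
    unfolding q_def using int[OF that] int[OF z] by simp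
  have "(\<lambda>w. ((\<integral>t. f w t \<partial>M) - (\<integral>t. f z t \<partial>M)) / (w - z)) \<midarrow>z\<rightarrow> (\<integral>t. deriv (\<lambda>w. f w t) z \<partial>M)"
  proof (rule Lim_transform_eventually)
    show "(\<lambda>w. \<integral>t. q w t \<partial>M) \<midarrow>z\<rightarrow> (\<integral>t. deriv (\<lambda>w. f w t) z \<partial>M)"
      using lim by (auto simp: tendsto_at_iff_sequentially o_def)
    show "\<forall>\<^sub>F w in at z. (\<integral>t. q w t \<partial>M) = ((\<integral>t. f w t \<partial>M) - (\<integral>t. f z t \<partial>M)) / (w - z)"
      using eventually_at_topological[of "\<lambda>w. w \<in> U"] \<open>open U\<close> z quot
      by (auto simp: eventually_at_topological)
  qed
  then show "((\<lambda>w. \<integral>t. f w t \<partial>M) has_field_derivative (\<integral>t. deriv (\<lambda>w. f w t) z \<partial>M)) (at z)"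
    by (simp add: has_field_derivative_iff)
qed

lemma holomorphic_on_parameter_integral:
  fixes f :: "complex \<Rightarrow> 'a \<Rightarrow> complex"
  assumes "open U"
    and meas: "\<And>w. w \<in> U \<Longrightarrow> f w \<in> borel_measurable M"
    and holo: "\<And>t. t \<in> space M \<Longrightarrow> (\<lambda>w. f w t) holomorphic_on U"
    and dom: "\<And>z. z \<in> U \<Longrightarrow> \<exists>r>0. \<exists>h. integrable M h \<and> ball z r \<subseteq> U \<and>
                (\<forall>w\<in>ball z r. \<forall>t\<in>space M. norm (f w t) \<le> h t)"
  shows "(\<lambda>w. \<integral>t. f w t \<partial>M) holomorphic_on U"
proof -
  have "(\<lambda>w. \<integral>t. f w t \<partial>M) field_differentiable at z" if z: "z \<in> U" for z
  proof -
    from dom[OF z] obtain r h where r: "r > 0" "integrable M h" "ball z r \<subseteq> U"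
      "\<And>w t. w \<in> ball z r \<Longrightarrow> t \<in> space M \<Longrightarrow> norm (f w t) \<le> h t" by blast
    have "((\<lambda>w. \<integral>t. f w t \<partial>M) has_field_derivative (\<integral>t. deriv (\<lambda>w. f w t) z \<partial>M)) (at z)"
      using r meas holomorphic_on_subset[OF holo r(3)] by (intro DERIV_parameter_integral[of z "ball z r" f M h]) auto
    then show ?thesis by (auto simp: field_differentiable_def)
  qed
  then show ?thesis using field_differentiable_at_within holomorphic_on_def by blast
qed

section \<open>The power series of the Bessel functions\<close>

text \<open>The Bessel-Clifford function, a regularized 0F1. With the power of \<open>z / 2\<close>
  taken out, what remains is entire in order and argument and serves \<open>J\<close> at
  \<open>y = - z^2 / 4\<close> and \<open>I\<close> at \<open>y = z^2 / 4\<close>.\<close>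

definition bessel_series :: "complex \<Rightarrow> complex \<Rightarrow> complex" where
  "bessel_series \<nu> y = (\<Sum>k. y ^ k * rGamma (\<nu> + of_nat k + 1) / fact k)"

lemma continuous_on_rGamma_complex [continuous_intros]:
  "continuous_on A f \<Longrightarrow> continuous_on A (\<lambda>x. rGamma (f x :: complex))"
  using continuous_on_compose2[OF continuous_on_rGamma[of UNIV]] by blast

text \<open>Compactness handles the finitely many k up to some n \<ge> R. Beyond,
  \<open>|nu + k + 1|\<close> is at least 1, so \<open>rGamma w = w * rGamma (w + 1)\<close> makes
  the norms nonincreasing in k.\<close>

lemma norm_rGamma_shift_bounded:
  obtains B where "B \<ge> 0"
    "\<And>\<nu> k. \<nu> \<in> cball 0 R \<Longrightarrow> norm (rGamma (\<nu> + of_nat k + 1 :: complex)) \<le> B"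
proof -
  obtain n :: nat where n: "real n \<ge> R" using real_arch_simple by blast
  have "compact (\<Union>k\<in>{..n}. (\<lambda>\<nu>. rGamma (\<nu> + of_nat k + 1 :: complex)) ` cball 0 R)"
    by (intro compact_UN finite_atMost ballI compact_continuous_image continuous_intros) auto
  then have "bounded (\<Union>k\<in>{..n}. (\<lambda>\<nu>. rGamma (\<nu> + of_nat k + 1 :: complex)) ` cball 0 R)"
    by (rule compact_imp_bounded)
  then obtain B where B: "B > 0"
    "\<And>k \<nu>. k \<le> n \<Longrightarrow> \<nu> \<in> cball 0 R \<Longrightarrow> norm (rGamma (\<nu> + of_nat k + 1 :: complex)) \<le> B"
    unfolding bounded_pos by fastforce
  have "norm (rGamma (\<nu> + of_nat k + 1)) \<le> B" if \<nu>: "\<nu> \<in> cball 0 R" for \<nu> :: complex and k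
  proof (induction k)
    case 0
    then show ?case using B(2)[of 0 \<nu>] \<nu> by simp
  next
    case (Suc k)
    show ?case
    proof (cases "Suc k \<le> n")
      case True
      then show ?thesis using B(2)[of "Suc k" \<nu>] \<nu> by simp
    next
      case False
      have "real n \<le> real k" using False by simp
      moreover have "norm (of_nat (k + 1) :: complex) = real k + 1" by (simp only: norm_of_nat)
      ultimately have "1 \<le> norm (of_nat (k + 1) :: complex) - norm \<nu>" using \<nu> n by simp
      also have "\<dots> \<le> norm (\<nu> + of_nat k + 1)"
        using norm_triangle_ineq2[of "of_nat (k + 1) :: complex" "- \<nu>"] by (simp add: algebra_simps)
      finally have "1 * norm (rGamma (\<nu> + of_nat k + 1 + 1)) \<le> norm (\<nu> + of_nat k + 1) * norm (rGamma (\<nu> + of_nat k + 1 + 1))"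
        by (intro mult_right_mono) auto
      also have "\<dots> = norm (rGamma (\<nu> + of_nat k + 1))"
        by (metis norm_mult rGamma_plus1)
      finally show ?thesis using Suc by (simp add: algebra_simps)
    qed
  qed
  then show ?thesis using that[of B] B(1) by auto
qed

lemma bessel_series_term_bound:
  obtains B where "B \<ge> 0" "\<And>\<nu> y k. \<nu> \<in> cball 0 R \<Longrightarrow> y \<in> cball 0 Y \<Longrightarrow>
    norm (y ^ k * rGamma (\<nu> + of_nat k + 1) / fact k :: complex) \<le> B * (Y ^ k / fact k)"
proof -
  obtain B where B: "B \<ge> 0" "\<And>\<nu> k. \<nu> \<in> cball 0 R \<Longrightarrow> norm (rGamma (\<nu> + of_nat k + 1 :: complex)) \<le> B"
    using norm_rGamma_shift_bounded[of R] by blast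
  show ?thesis
  proof (rule that[OF B(1)])
    fix \<nu> y :: complex and k assume *: "\<nu> \<in> cball 0 R" "y \<in> cball 0 Y"
    have "norm y ^ k * norm (rGamma (\<nu> + of_nat k + 1)) \<le> Y ^ k * B"
      using * by (intro mult_mono power_mono B) (auto intro: zero_le_power order_trans[OF norm_ge_zero])
    then have "norm y ^ k * norm (rGamma (\<nu> + of_nat k + 1)) / fact k \<le> Y ^ k * B / fact k"
      by (rule divide_right_mono) simp
    then show "norm (y ^ k * rGamma (\<nu> + of_nat k + 1) / fact k) \<le> B * (Y ^ k / fact k)"
      by (simp add: norm_mult norm_divide norm_power mult_ac)
  qed
qed

lemma summable_power_fact_mult: "summable (\<lambda>k. B * (Y ^ k / fact k :: real))"
  using summable_exp[of Y] by (intro summable_mult) (simp add: field_simps)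

lemma summable_bessel_series: "summable (\<lambda>k. y ^ k * rGamma (\<nu> + of_nat k + 1) / fact k :: complex)"
proof -
  obtain B where "\<And>k. norm (y ^ k * rGamma (\<nu> + of_nat k + 1) / fact k :: complex) \<le> B * (norm y ^ k / fact k)"
    using bessel_series_term_bound[of "norm \<nu>" "norm y"] by (metis mem_cball_0 order_refl)
  then show ?thesis using summable_power_fact_mult by (rule summable_comparison_test'[rotated])
qed

lemma uniform_limit_bessel_series:
  "uniform_limit (cball 0 R \<times> cball 0 Y)
     (\<lambda>n (\<nu>, y). \<Sum>k<n. y ^ k * rGamma (\<nu> + of_nat k + 1) / fact k) (\<lambda>(\<nu>, y). bessel_series \<nu> y) sequentially"
proof -
  obtain B where B: "B \<ge> 0" "\<And>\<nu> y k. \<nu> \<in> cball 0 R \<Longrightarrow> y \<in> cball 0 Y \<Longrightarrow>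
    norm (y ^ k * rGamma (\<nu> + of_nat k + 1) / fact k :: complex) \<le> B * (Y ^ k / fact k)"
    by (fact bessel_series_term_bound[of R Y])
  have "uniform_limit (cball 0 R \<times> cball 0 Y)
     (\<lambda>n x. \<Sum>k<n. (case x of (\<nu>, y) \<Rightarrow> (y ^ k * rGamma (\<nu> + of_nat k + 1) / fact k :: complex)))
     (\<lambda>x. \<Sum>k. (case x of (\<nu>, y) \<Rightarrow> (y ^ k * rGamma (\<nu> + of_nat k + 1) / fact k :: complex))) sequentially"
    by (rule Weierstrass_m_test[OF _ summable_power_fact_mult[of B Y]]) (use B(2) in fastforce)
  then show ?thesis by (simp add: bessel_series_def case_prod_unfold)
qed

text \<open>Joint continuity is what later makes the constants in the bound for \<open>J\<close>
  uniform over compact sets of orders and starting points at once.\<close>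

lemma continuous_on_bessel_series_pair: "continuous_on UNIV (\<lambda>(\<nu>, y). bessel_series \<nu> y)"
proof -
  have "continuous_on (ball 0 R \<times> ball 0 R) (\<lambda>(\<nu>, y). bessel_series \<nu> y)" for R
  proof (rule continuous_on_subset[of "cball 0 R \<times> cball 0 R"])
    show "continuous_on (cball 0 R \<times> cball 0 R) (\<lambda>(\<nu>, y). bessel_series \<nu> y)"
      by (rule uniform_limit_theorem[OF _ uniform_limit_bessel_series])
         (auto intro!: always_eventually continuous_intros simp: case_prod_unfold)
  qed auto
  then have "continuous_on (\<Union>R\<in>UNIV. ball 0 R \<times> ball 0 R) (\<lambda>(\<nu>, y). bessel_series \<nu> y)"
    by (intro continuous_on_open_UN) (auto intro: open_Times)
  moreover have "(\<Union>R\<in>UNIV. ball (0::complex) R \<times> ball (0::complex) R) = UNIV"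
  proof -
    have "(a, b) \<in> ball 0 (norm a + norm b + 1) \<times> ball 0 (norm a + norm b + 1)" for a b :: complex
      using norm_ge_zero[of a] norm_ge_zero[of b] by (simp add: mem_Times_iff del: norm_ge_zero)
    then have "p \<in> (\<Union>R\<in>UNIV. ball (0::complex) R \<times> ball (0::complex) R)" for p
      by (cases p) (metis UN_I UNIV_I)
    then show ?thesis by (intro equalityI subsetI UNIV_I)
  qed
  ultimately show ?thesis by simp
qed

lemma continuous_on_bessel_series [continuous_intros]:
  assumes "continuous_on A f" "continuous_on A g"
  shows "continuous_on A (\<lambda>x. bessel_series (f x) (g x))"
  using continuous_on_compose2[OF continuous_on_bessel_series_pair continuous_on_Pair[OF assms]] by simp

lemma DERIV_bessel_series:
  "(bessel_series \<nu> has_field_derivative bessel_series (\<nu> + 1) y) (at y)"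
proof -
  define c where "c k = rGamma (\<nu> + of_nat k + 1) / fact k" for k
  have "((\<lambda>y. \<Sum>k. c k * y ^ k) has_field_derivative (\<Sum>k. diffs c k * y ^ k)) (at y)"
    by (rule termdiffs_strong_converges_everywhere)
       (use summable_bessel_series[of _ \<nu>] in \<open>simp add: c_def mult.commute\<close>)
  moreover have "diffs c k = rGamma (\<nu> + 1 + of_nat k + 1) / fact k" for k
  proof -
    have "of_nat (Suc k) * (r / (of_nat (Suc k) * fact k)) = r / fact k" for r :: complex
      by (simp add: divide_simps del: of_nat_Suc)
    then show ?thesis unfolding diffs_def c_def by (simp add: add_ac)
  qed
  ultimately show ?thesis
    by (simp add: c_def bessel_series_def[abs_def] mult_ac)
qed

lemma bessel_series_holomorphic_order [holomorphic_intros]: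
  assumes "f holomorphic_on A"
  shows "(\<lambda>\<nu>. bessel_series (f \<nu>) y) holomorphic_on A"
proof -
  have "(\<lambda>\<nu>. bessel_series \<nu> y) holomorphic_on UNIV"
  proof (rule holomorphic_uniform_sequence[OF open_UNIV])
    show "(\<lambda>\<nu>. \<Sum>k<n. y ^ k * rGamma (\<nu> + of_nat k + 1) / fact k) holomorphic_on UNIV" for n
      by (intro holomorphic_intros) auto
    fix \<nu> :: complex
    have "uniform_limit (cball 0 (norm \<nu> + 1) \<times> cball 0 (norm y))
     (\<lambda>n (\<nu>, y). \<Sum>k<n. y ^ k * rGamma (\<nu> + of_nat k + 1) / fact k) (\<lambda>(\<nu>, y). bessel_series \<nu> y) sequentially"
      by (rule uniform_limit_bessel_series)
    then have "uniform_limit (cball \<nu> 1) (\<lambda>n \<nu>. \<Sum>k<n. y ^ k * rGamma (\<nu> + of_nat k + 1) / fact k)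
      (\<lambda>\<nu>. bessel_series \<nu> y) sequentially"
      by (rule uniform_limit_compose'[where f = "\<lambda>n (\<nu>, y). \<Sum>k<n. y ^ k * rGamma (\<nu> + of_nat k + 1) / fact k"
            and g = "\<lambda>(\<nu>, y). bessel_series \<nu> y" and h = "\<lambda>\<nu>. (\<nu>, y)", simplified])
         (use norm_triangle_sub[of _ \<nu>] in \<open>fastforce simp: dist_norm norm_minus_commute Pi_iff intro: order_trans\<close>)
    then show "\<exists>d>0. cball \<nu> d \<subseteq> UNIV \<and> uniform_limit (cball \<nu> d)
       (\<lambda>n \<nu>. \<Sum>k<n. y ^ k * rGamma (\<nu> + of_nat k + 1) / fact k) (\<lambda>\<nu>. bessel_series \<nu> y) sequentially"
      by (intro exI[of _ 1]) auto
  qed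
  from holomorphic_on_compose_gen[OF assms this] show ?thesis by (simp add: o_def)
qed

lemma bessel_series_holomorphic [holomorphic_intros]:
  assumes "f holomorphic_on A"
  shows "(\<lambda>z. bessel_series \<nu> (f z)) holomorphic_on A"
proof -
  have "bessel_series \<nu> holomorphic_on UNIV"
    using DERIV_bessel_series by (meson field_differentiable_def holomorphic_on_def has_field_derivative_at_within)
  from holomorphic_on_compose_gen[OF assms this] show ?thesis by (simp add: o_def)
qed

text \<open>Termwise, 1/Gamma(\<nu>+k) = (\<nu>+k)/Gamma(\<nu>+k+1). The part with \<nu> is the
  first summand; the part with k, after an index shift, is the second.\<close>

lemma bessel_series_recurrence:
  "bessel_series (\<nu> - 1) y = \<nu> * bessel_series \<nu> y + y * bessel_series (\<nu> + 1) y"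
proof -
  define a where "a k = y ^ k * rGamma (\<nu> + of_nat k + 1) / fact k" for k
  have eq: "y ^ k * rGamma (\<nu> - 1 + of_nat k + 1) / fact k = \<nu> * a k + of_nat k * a k" for k
    using rGamma_plus1[of "\<nu> + of_nat k"] unfolding a_def
    by (simp add: add_divide_distrib[symmetric] distrib_right[symmetric])
  have s: "summable (\<lambda>k. \<nu> * a k)" using summable_bessel_series[of y \<nu>] unfolding a_def by (intro summable_mult)
  have "summable (\<lambda>k. (\<nu> * a k + of_nat k * a k) - \<nu> * a k)"
    using summable_diff[OF summable_bessel_series[of y "\<nu> - 1", unfolded eq] s] .
  then have s': "summable (\<lambda>k. of_nat k * a k)" by simp
  have shift: "of_nat (Suc k) * a (Suc k) = y * (y ^ k * rGamma (\<nu> + 1 + of_nat k + 1) / fact k)" for k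
  proof -
    have "of_nat (Suc k) * (r / (of_nat (Suc k) * fact k)) = r / fact k" for r :: complex
      by (simp add: divide_simps del: of_nat_Suc)
    then show ?thesis unfolding a_def by (simp add: add_ac mult_ac del: of_nat_Suc) (simp add: add_ac)
  qed
  have "bessel_series (\<nu> - 1) y = (\<Sum>k. \<nu> * a k) + (\<Sum>k. of_nat k * a k)"
    unfolding bessel_series_def eq by (rule suminf_add[OF s s', symmetric])
  also have "(\<Sum>k. \<nu> * a k) = \<nu> * bessel_series \<nu> y"
    using summable_bessel_series[of y \<nu>] unfolding a_def bessel_series_def by (rule suminf_mult)
  also have "(\<Sum>k. of_nat k * a k) = (\<Sum>k. of_nat (Suc k) * a (Suc k))"
    using suminf_split_head[OF s'] by simp
  also have "\<dots> = y * bessel_series (\<nu> + 1) y"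
    unfolding shift bessel_series_def by (rule suminf_mult[OF summable_bessel_series])
  finally show ?thesis .
qed

lemma bessel_series_0: "bessel_series \<nu> 0 = rGamma (\<nu> + 1)"
  using suminf_finite[of "{0}" "\<lambda>k. 0 ^ k * rGamma (\<nu> + of_nat k + 1) / fact k"] by (simp add: bessel_series_def power_0_left)

lemma bessel_J_eq_series: "bessel_J \<nu> z = (z / 2) powr \<nu> * bessel_series \<nu> (- (z\<^sup>2 / 4))"
proof -
  have "(- 1) ^ k * (z / 2) ^ (2 * k) = (- (z\<^sup>2 / 4)) ^ k" for k
    unfolding power_mult power_minus[of "z\<^sup>2 / 4"] by (simp add: power_divide)
  then show ?thesis unfolding bessel_J_def bessel_series_def by simp
qed

section \<open>The integral representation of K\<close>

lemma integrable_exp_minus_abs: "integrable lborel (\<lambda>t::real. exp (- \<bar>t\<bar>))"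
proof -
  have pos: "(\<lambda>t::real. exp (- \<bar>t\<bar>)) absolutely_integrable_on {0..}"
  proof -
    have "(\<lambda>t::real. exp (- (1 * t))) absolutely_integrable_on {0..}"
      using has_integral_exp_minus_to_infinity[of 1 0]
      by (intro nonnegative_absolutely_integrable_1) (auto simp: integrable_on_def)
    then show ?thesis
      by (rule absolutely_integrable_spike[OF _ negligible_empty]) auto
  qed
  have "(\<lambda>t::real. \<bar>- 1\<bar> *\<^sub>R exp (- \<bar>- t\<bar>)) absolutely_integrable_on {0..}" using pos by simp
  then have "(\<lambda>t::real. exp (- \<bar>t\<bar>)) absolutely_integrable_on uminus ` {0..}"
    by (subst absolutely_integrable_change_of_variables_real[where h = "\<lambda>_. - 1"])
       (auto intro!: derivative_eq_intros)
  then have "(\<lambda>t::real. exp (- \<bar>t\<bar>)) absolutely_integrable_on (uminus ` {0..} \<union> {0..})"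
    using pos by (rule absolutely_integrable_Un)
  moreover have "uminus ` {0..} \<union> {0::real..} = UNIV"
    by (auto simp: image_iff)
  ultimately have "integrable lebesgue (\<lambda>t::real. exp (- \<bar>t\<bar>))"
    by (simp add: set_integrable_def)
  then show ?thesis by (subst (asm) integrable_completion) auto
qed

lemma cosh_ge_square: "t\<^sup>2 / 4 \<le> cosh (t::real)"
proof -
  have "1 + \<bar>t\<bar> + \<bar>t\<bar>\<^sup>2 / 2 \<le> exp \<bar>t\<bar>" by (rule exp_lower_Taylor_quadratic) simp
  moreover have "exp \<bar>t\<bar> \<le> 2 * cosh t" by (simp add: cosh_def abs_if)
  ultimately show ?thesis by simp
qed

definition K_kernel :: "complex \<Rightarrow> complex \<Rightarrow> real \<Rightarrow> complex" where
  "K_kernel \<nu> x t = exp (- (x * of_real (cosh t)) - \<nu> * of_real t)"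

text \<open>Meaningful for \<open>Re x > 0\<close>, where the kernel is integrable. Integrating
  \<open>exp (- nu t)\<close> over the whole line, and not \<open>cosh (nu t)\<close> over a
  half-line, makes multiplication by \<open>exp (mu t)\<close> a mere shift of the order.\<close>

definition bessel_K :: "complex \<Rightarrow> complex \<Rightarrow> complex" where
  "bessel_K \<nu> x = (\<integral>t. K_kernel \<nu> x t \<partial>lborel) / 2"

text \<open>Since \<open>cosh t\<close> is at least \<open>t^2 / 4\<close>, completing a square
  absorbs \<open>(N + 1) |t|\<close> into \<open>d * cosh t\<close> at the cost of the constant
  \<open>(N + 1)^2 / d\<close>. Using N + 1 in place of N leaves the integrable factor
  \<open>exp (- |t|)\<close>.\<close>

lemma norm_K_kernel_le:
  assumes "Re x \<ge> d" "d > 0" "\<bar>Re \<nu>\<bar> \<le> N"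
  shows "norm (K_kernel \<nu> x t) \<le> exp ((N + 1)\<^sup>2 / d) * exp (- \<bar>t\<bar>)"
proof -
  have "0 \<le> (sqrt d * \<bar>t\<bar> / 2 - (N + 1) / sqrt d)\<^sup>2" by simp
  also have "\<dots> = d * t\<^sup>2 / 4 - (N + 1) * \<bar>t\<bar> + (N + 1)\<^sup>2 / d"
    using assms(2) by (simp add: power2_diff power_divide power_mult_distrib)
  finally have "(N + 1) * \<bar>t\<bar> \<le> d * (t\<^sup>2 / 4) + (N + 1)\<^sup>2 / d" by simp
  also have "d * (t\<^sup>2 / 4) \<le> Re x * cosh t"
    using assms cosh_ge_square[of t] by (intro mult_mono) auto
  finally have "N * \<bar>t\<bar> - Re x * cosh t \<le> (N + 1)\<^sup>2 / d - \<bar>t\<bar>" by (simp add: algebra_simps)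
  moreover have "- (Re \<nu> * t) \<le> N * \<bar>t\<bar>"
    using assms(3) mult_right_mono[of "\<bar>Re \<nu>\<bar>" N "\<bar>t\<bar>"] abs_ge_minus_self[of "Re \<nu> * t"] by (simp add: abs_mult)
  ultimately have "- (Re x * cosh t) - Re \<nu> * t \<le> (N + 1)\<^sup>2 / d - \<bar>t\<bar>" by linarith
  then show ?thesis by (simp add: K_kernel_def flip: exp_add)
qed

lemma continuous_on_K_kernel [continuous_intros]:
  assumes "continuous_on A f" "continuous_on A g" "continuous_on A h"
  shows "continuous_on A (\<lambda>x. K_kernel (f x) (g x) (h x))"
  unfolding K_kernel_def cosh_def by (intro continuous_intros assms)

lemma borel_measurable_K_kernel [measurable]: "K_kernel \<nu> x \<in> borel_measurable borel"
proof (rule borel_measurable_continuous_onI)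
  show "continuous_on UNIV (K_kernel \<nu> x)"
    using continuous_on_K_kernel[of UNIV "\<lambda>_. \<nu>" "\<lambda>_. x" "\<lambda>t. t"] by (simp add: continuous_intros)
qed

lemma integrable_K_kernel:
  assumes "Re x > 0"
  shows "integrable lborel (K_kernel \<nu> x)"
proof (rule Bochner_Integration.integrable_bound)
  show "integrable lborel (\<lambda>t. exp ((\<bar>Re \<nu>\<bar> + 1)\<^sup>2 / Re x) * exp (- \<bar>t\<bar>))"
    using integrable_exp_minus_abs by simp
qed (use assms norm_K_kernel_le[of "Re x" x \<nu> "\<bar>Re \<nu>\<bar>"] in \<open>auto intro!: AE_I2\<close>)

lemma K_kernel_mult_exp: "K_kernel \<nu> x t * exp (\<mu> * of_real t) = K_kernel (\<nu> - \<mu>) x t"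
  by (simp add: K_kernel_def algebra_simps flip: exp_add)

lemma K_kernel_mult_cosh: "K_kernel \<nu> x t * of_real (cosh t) = (K_kernel (\<nu> - 1) x t + K_kernel (\<nu> + 1) x t) / 2"
  using K_kernel_mult_exp[of \<nu> x t 1] K_kernel_mult_exp[of \<nu> x t "-1"]
  by (simp add: cosh_def exp_of_real[symmetric] distrib_left add_divide_distrib)

lemma K_kernel_mult_sinh: "K_kernel \<nu> x t * of_real (sinh t) = (K_kernel (\<nu> - 1) x t - K_kernel (\<nu> + 1) x t) / 2"
  using K_kernel_mult_exp[of \<nu> x t 1] K_kernel_mult_exp[of \<nu> x t "-1"]
  by (simp add: sinh_def exp_of_real[symmetric] right_diff_distrib diff_divide_distrib)

lemma DERIV_bessel_K:
  assumes "Re x > 0"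
  shows "(bessel_K \<nu> has_field_derivative - (bessel_K (\<nu> - 1) x + bessel_K (\<nu> + 1) x) / 2) (at x)"
proof -
  \<comment> \<open>Halving the real part keeps the majorant of \<open>norm_K_kernel_le\<close>
    fixed on a neighbourhood of \<open>x\<close>.\<close>
  define U where "U = {w. Re w > Re x / 2}"
  have der: "((\<lambda>w. K_kernel \<nu> w t) has_field_derivative - (K_kernel \<nu> w t * of_real (cosh t))) (at w)" for w t
    unfolding K_kernel_def by (auto intro!: derivative_eq_intros)
  have "((\<lambda>w. \<integral>t. K_kernel \<nu> w t \<partial>lborel) has_field_derivative
      (\<integral>t. deriv (\<lambda>w. K_kernel \<nu> w t) x \<partial>lborel)) (at x)"
  proof (rule DERIV_parameter_integral)
    show "open U" unfolding U_def by (rule open_halfspace_Re_gt)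
    show "x \<in> U" using assms by (simp add: U_def)
    show "(\<lambda>w. K_kernel \<nu> w t) holomorphic_on U" for t
      using der by (meson field_differentiable_def holomorphic_on_def has_field_derivative_at_within)
    show "integrable lborel (\<lambda>t. exp ((\<bar>Re \<nu>\<bar> + 1)\<^sup>2 / (Re x / 2)) * exp (- \<bar>t\<bar>))"
      using integrable_exp_minus_abs by simp
    show "norm (K_kernel \<nu> w t) \<le> exp ((\<bar>Re \<nu>\<bar> + 1)\<^sup>2 / (Re x / 2)) * exp (- \<bar>t\<bar>)" if "w \<in> U" for w t
      by (rule norm_K_kernel_le) (use that assms in \<open>auto simp: U_def\<close>)
  qed auto
  moreover have "(\<lambda>t. deriv (\<lambda>w. K_kernel \<nu> w t) x) = (\<lambda>t. - ((K_kernel (\<nu> - 1) x t + K_kernel (\<nu> + 1) x t) / 2))"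
    using DERIV_imp_deriv[OF der] by (simp add: K_kernel_mult_cosh)
  ultimately have "((\<lambda>w. \<integral>t. K_kernel \<nu> w t \<partial>lborel) has_field_derivative
      - (bessel_K (\<nu> - 1) x + bessel_K (\<nu> + 1) x)) (at x)"
    using integrable_K_kernel[OF assms] by (simp add: bessel_K_def add_divide_distrib)
  from DERIV_cdivide[OF this, of 2] show ?thesis by (simp add: bessel_K_def[abs_def])
qed

lemma integral_derivative_real_line:
  fixes f F :: "real \<Rightarrow> complex"
  assumes "\<And>t. (F has_vector_derivative f t) (at t)" "\<And>t. isCont f t" "integrable lborel f"
    "(F \<longlongrightarrow> A) at_bot" "(F \<longlongrightarrow> B) at_top"
  shows "(\<integral>t. f t \<partial>lborel) = B - A"
proof -
  have "(LBINT t=-\<infinity>..\<infinity>. f t) = B - A"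
    by (rule interval_integral_FTC_integrable)
       (use assms in \<open>auto simp: set_integrable_def ereal_tendsto_simps\<close>)
  then show ?thesis by (simp add: interval_lebesgue_integral_def set_lebesgue_integral_def)
qed

lemma K_kernel_tendsto_0_at_top:
  assumes "Re x > 0"
  shows "(K_kernel \<nu> x \<longlongrightarrow> 0) at_top"
proof (rule Lim_null_comparison)
  show "\<forall>\<^sub>F t in at_top. norm (K_kernel \<nu> x t) \<le> exp ((\<bar>Re \<nu>\<bar> + 1)\<^sup>2 / Re x) * exp (- \<bar>t\<bar>)"
    using assms by (intro always_eventually allI norm_K_kernel_le) auto
  show "((\<lambda>t::real. exp ((\<bar>Re \<nu>\<bar> + 1)\<^sup>2 / Re x) * exp (- \<bar>t\<bar>)) \<longlongrightarrow> 0) at_top"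
    by (intro tendsto_mult_right_zero filterlim_compose[OF exp_at_bot]
        filterlim_compose[OF filterlim_uminus_at_bot_at_top filterlim_abs_real])
qed

lemma K_kernel_tendsto_0_at_bot:
  assumes "Re x > 0"
  shows "(K_kernel \<nu> x \<longlongrightarrow> 0) at_bot"
  using K_kernel_tendsto_0_at_top[OF assms, of "- \<nu>"]
  by (simp add: filterlim_at_bot_mirror K_kernel_def[abs_def])

text \<open>The kernel vanishes at both ends of the line, so its derivative in \<open>t\<close> has
  integral 0; the factor \<open>sinh t\<close> that appears shifts the order both ways.\<close>

lemma bessel_K_recurrence:
  assumes "Re x > 0"
  shows "x * (bessel_K (\<nu> + 1) x - bessel_K (\<nu> - 1) x) = 2 * \<nu> * bessel_K \<nu> x"
proof -
  have I: "integrable lborel (K_kernel \<mu> x)" for \<mu> by (rule integrable_K_kernel[OF assms])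
  have "(\<integral>t. x * ((K_kernel (\<nu> + 1) x t - K_kernel (\<nu> - 1) x t) / 2) - \<nu> * K_kernel \<nu> x t \<partial>lborel) = 0 - 0"
  proof (rule integral_derivative_real_line)
    show "(K_kernel \<nu> x has_vector_derivative x * ((K_kernel (\<nu> + 1) x t - K_kernel (\<nu> - 1) x t) / 2) - \<nu> * K_kernel \<nu> x t) (at t)" for t
    proof -
      have "(K_kernel \<nu> x has_vector_derivative
          (- (x * of_real (sinh t)) - \<nu> * of_real 1) * exp (- (x * of_real (cosh t)) - \<nu> * of_real t)) (at t)"
        unfolding K_kernel_def
        by (rule field_vector_diff_chain_at[where f = "\<lambda>t. - (x * of_real (cosh t)) - \<nu> * of_real t" and g = exp, unfolded o_def])
           (auto intro!: derivative_eq_intros)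
      also have "(- (x * of_real (sinh t)) - \<nu> * of_real 1) * exp (- (x * of_real (cosh t)) - \<nu> * of_real t)
         = - x * (K_kernel \<nu> x t * of_real (sinh t)) - \<nu> * K_kernel \<nu> x t"
        by (simp add: K_kernel_def algebra_simps)
      also have "\<dots> = x * ((K_kernel (\<nu> + 1) x t - K_kernel (\<nu> - 1) x t) / 2) - \<nu> * K_kernel \<nu> x t"
        unfolding K_kernel_mult_sinh by (simp add: algebra_simps)
      finally show ?thesis .
    qed
    show "isCont (\<lambda>t. x * ((K_kernel (\<nu> + 1) x t - K_kernel (\<nu> - 1) x t) / 2) - \<nu> * K_kernel \<nu> x t) t" for t
      by (intro continuous_on_interior[of UNIV] continuous_intros) auto
  qed (use I K_kernel_tendsto_0_at_top[OF assms] K_kernel_tendsto_0_at_bot[OF assms] in auto)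
  then show ?thesis using I by (simp add: bessel_K_def algebra_simps diff_divide_distrib)
qed

lemma bessel_K_minus: "bessel_K (- \<nu>) x = bessel_K \<nu> x"
  using lborel_integral_real_affine[of "-1" "K_kernel \<nu> x" 0] by (simp add: bessel_K_def K_kernel_def)

section \<open>Behaviour of \<open>bessel_K\<close> at the origin\<close>

lemma range_exp_real: "range (exp :: real \<Rightarrow> real) = {0<..}"
  by (auto simp: image_iff) (metis exp_ln)

text \<open>Euler's integral with its variable replaced by \<open>exp t\<close>, the shape in which
  it arises as the limit of the integral for \<open>K\<close> at 0.\<close>

lemma
  fixes l :: real
  assumes "l > 0"
  shows integrable_exp_Gamma: "integrable lborel (\<lambda>t. exp (l * t - exp t))"
    and integral_exp_Gamma: "(\<integral>t. exp (l * t - exp t) \<partial>lborel) = Gamma l"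
proof -
  have "((\<lambda>t. t powr (l - 1) / exp t) has_integral Gamma l) {0<..}"
    using Gamma_integral_real[OF assms]
    by (subst (asm) has_integral_spike_set_eq[of _ "{0<..}"]) (auto intro: empty_imp_negligible negligible_subset[of "{0}"])
  then have "(\<lambda>t. t powr (l - 1) / exp t) absolutely_integrable_on {0<..} \<and>
      integral {0<..} (\<lambda>t. t powr (l - 1) / exp t) = Gamma l"
    by (auto intro!: nonnegative_absolutely_integrable_1 simp: has_integral_iff)
  then have "(\<lambda>t. \<bar>exp t\<bar> *\<^sub>R (exp t powr (l - 1) / exp (exp t))) absolutely_integrable_on UNIV \<and>
      integral UNIV (\<lambda>t. \<bar>exp t\<bar> *\<^sub>R (exp t powr (l - 1) / exp (exp t))) = Gamma l"
    by (subst has_absolute_integral_change_of_variables_real[where g = exp and h = exp and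
          f = "\<lambda>t. t powr (l - 1) / exp t"]) (auto simp: range_exp_real inj_on_def intro!: derivative_eq_intros)
  moreover have "\<bar>exp t\<bar> *\<^sub>R (exp t powr (l - 1) / exp (exp t)) = exp (l * t - exp t)" for t :: real
    by (simp add: powr_def exp_diff algebra_simps)
  ultimately have *: "integrable lebesgue (\<lambda>t. exp (l * t - exp t))" "integral UNIV (\<lambda>t. exp (l * t - exp t)) = Gamma l"
    by (auto simp: set_integrable_def)
  show I: "integrable lborel (\<lambda>t. exp (l * t - exp t))"
    using *(1) by (subst (asm) integrable_completion) auto
  show "(\<integral>t. exp (l * t - exp t) \<partial>lborel) = Gamma l"
    using integral_lborel[OF I] *(2) by simp
qed

text \<open>Shifting \<open>t\<close> by \<open>ln (2 / x)\<close> turns \<open>x cosh t\<close>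
  into \<open>exp t + x^2 exp (- t) / 4\<close> and absorbs the power of \<open>x / 2\<close>. As x
  tends to 0 the second term disappears, and the integrand is dominated by the one of
  \<open>integral_exp_Gamma\<close>.\<close>

lemma bessel_K_asymptotic_0:
  fixes l :: real
  assumes "l > 0"
  shows "((\<lambda>x. (of_real x / 2) powr of_real l * bessel_K (of_real l) (of_real x)) \<longlongrightarrow> Gamma (of_real l) / 2) (at_right 0)"
proof -
  define g where "g x t = exp (l * t - exp t - x\<^sup>2 * exp (- t) / 4)" for x t :: real
  have eq: "(of_real x / 2) powr of_real l * bessel_K (of_real l) (of_real x) = of_real ((\<integral>t. g x t \<partial>lborel) / 2)"
    if x: "x > 0" for x
  proof -
    \<comment> \<open>The symmetry in the order replaces \<open>exp (- l t)\<close> by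
      \<open>exp (l t)\<close>, the sign for which the limit is Euler's integral.\<close>
    have K: "bessel_K (of_real l) (of_real x) = (\<integral>t. K_kernel (- of_real l) (of_real x) t \<partial>lborel) / 2"
      using bessel_K_minus[of "of_real l" "of_real x"] by (simp add: bessel_K_def)
    have 1: "(x / 2) powr l * exp (l * (ln (2 / x) + t) - x * cosh (ln (2 / x) + t)) = g x t" for t
    proof -
      have c: "x * cosh (ln (2 / x) + t) = exp t + x\<^sup>2 * exp (- t) / 4"
        using x by (simp add: cosh_def exp_add exp_minus exp_diff power2_eq_square field_simps)
      have "l * ln (x / 2) + l * (ln (2 / x) + t) = l * t" using x by (simp add: ln_div algebra_simps)
      then show ?thesis using x unfolding g_def c by (simp add: powr_def exp_add[symmetric])
    qed
    have "(\<integral>t. K_kernel (- of_real l) (of_real x) t \<partial>lborel) = (\<integral>t. K_kernel (- of_real l) (of_real x) (ln (2 / x) + 1 * t) \<partial>lborel)"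
      using lborel_integral_real_affine[of 1 "K_kernel (- of_real l) (of_real x)" "ln (2 / x)"] by simp
    also have "\<dots> = (\<integral>t. complex_of_real (exp (l * (ln (2 / x) + t) - x * cosh (ln (2 / x) + t))) \<partial>lborel)"
      by (intro Bochner_Integration.integral_cong) (simp_all add: K_kernel_def exp_of_real[symmetric])
    also have "of_real ((x / 2) powr l) * \<dots> = (\<integral>t. complex_of_real (g x t) \<partial>lborel)"
      unfolding integral_mult_right_zero[symmetric] of_real_mult[symmetric] 1 ..
    finally show ?thesis using x unfolding K by (simp add: powr_of_real[symmetric])
  qed
  have lim: "((\<lambda>x. \<integral>t. g x t \<partial>lborel) \<longlongrightarrow> Gamma l) (at_right 0)"
    unfolding tendsto_at_iff_sequentially o_def
  proof (intro allI impI)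
    fix X :: "nat \<Rightarrow> real" assume X: "\<forall>i. X i \<in> {0<..} - {0}" "X \<longlonglongrightarrow> 0"
    have "(\<lambda>i. \<integral>t. g (X i) t \<partial>lborel) \<longlonglongrightarrow> (\<integral>t. exp (l * t - exp t) \<partial>lborel)"
    proof (rule integral_dominated_convergence)
      have "(\<lambda>i. g (X i) t) \<longlonglongrightarrow> exp (l * t - exp t - 0\<^sup>2 * exp (- t) / 4)" for t
        unfolding g_def by (intro tendsto_intros X) auto
      then show "AE t in lborel. (\<lambda>i. g (X i) t) \<longlonglongrightarrow> exp (l * t - exp t)" by simp
      show "AE t in lborel. norm (g (X i) t) \<le> exp (l * t - exp t)" for i by (simp add: g_def)
      show "integrable lborel (\<lambda>t. exp (l * t - exp t))" by (rule integrable_exp_Gamma[OF assms])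
    qed (auto simp: g_def)
    then show "(\<lambda>i. \<integral>t. g (X i) t \<partial>lborel) \<longlonglongrightarrow> Gamma l" by (simp add: integral_exp_Gamma[OF assms])
  qed
  have "((\<lambda>x. complex_of_real ((\<integral>t. g x t \<partial>lborel) / 2)) \<longlongrightarrow> of_real (Gamma l / 2)) (at_right 0)"
    by (intro tendsto_intros lim) auto
  moreover have "\<forall>\<^sub>F x in at_right 0. complex_of_real ((\<integral>t. g x t \<partial>lborel) / 2) = (of_real x / 2) powr of_real l * bessel_K (of_real l) (of_real x)"
    using eq by (auto simp: eventually_at_right_less intro: eventually_at_rightI[of 0 1])
  ultimately show ?thesis
    using Lim_transform_eventually by (fastforce simp: Gamma_complex_of_real)
qed

section \<open>Connection of K with the power series\<close>

definition bessel_I :: "complex \<Rightarrow> complex \<Rightarrow> complex" where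
  "bessel_I \<nu> x = (x / 2) powr \<nu> * bessel_series \<nu> (x\<^sup>2 / 4)"

text \<open>In essence the Wronskian of \<open>I\<close> at orders \<nu> and -\<nu>. Without the
  powers it is entire in \<open>y\<close>, and the recurrence makes its derivative 0; so it equals
  its value at \<open>y = 0\<close>, a product of two reciprocal Gamma values given by the
  reflection formula.\<close>

lemma bessel_series_wronskian:
  "bessel_series (- \<nu>) y * bessel_series (\<nu> - 1) y - y * bessel_series \<nu> y * bessel_series (1 - \<nu>) y
    = sin (of_real pi * \<nu>) / of_real pi"
proof -
  define w where "w y = bessel_series (- \<nu>) y * bessel_series (\<nu> - 1) y
      - y * bessel_series \<nu> y * bessel_series (1 - \<nu>) y" for y
  have "(w has_field_derivative 0) (at y)" for y
  proof -
    have r1: "bessel_series (\<nu> - 1) y = \<nu> * bessel_series \<nu> y + y * bessel_series (\<nu> + 1) y"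
      by (rule bessel_series_recurrence)
    have r2: "bessel_series (- \<nu>) y = (1 - \<nu>) * bessel_series (1 - \<nu>) y + y * bessel_series (2 - \<nu>) y"
      using bessel_series_recurrence[of "1 - \<nu>" y] by simp
    have "(w has_field_derivative
        (bessel_series (- \<nu>) y * bessel_series (\<nu> - 1 + 1) y + bessel_series (- \<nu> + 1) y * bessel_series (\<nu> - 1) y)
        - ((y * bessel_series \<nu> y) * bessel_series (1 - \<nu> + 1) y
           + (y * bessel_series (\<nu> + 1) y + 1 * bessel_series \<nu> y) * bessel_series (1 - \<nu>) y)) (at y)"
      unfolding w_def by (intro DERIV_diff DERIV_mult' DERIV_ident DERIV_bessel_series)
    then show ?thesis by (simp add: r1 r2 algebra_simps)
  qed
  then have "w y = w 0"
    using has_field_derivative_zero_constant[OF convex_UNIV, of w] by auto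
  also have "w 0 = rGamma (1 - \<nu>) * rGamma \<nu>" by (simp add: w_def bessel_series_0)
  also have "\<dots> = sin (of_real pi * \<nu>) / of_real pi"
    using rGamma_reflection_complex[of \<nu>] by (simp add: mult.commute)
  finally show ?thesis by (simp add: w_def)
qed

lemma DERIV_half_powr:
  fixes z :: complex
  assumes "z \<notin> \<real>\<^sub>\<le>\<^sub>0"
  shows "((\<lambda>x. (x / 2) powr \<nu>) has_field_derivative \<nu> * (z / 2) powr \<nu> / z) (at z)"
proof -
  have z: "z \<noteq> 0" "z / 2 \<notin> \<real>\<^sub>\<le>\<^sub>0" using assms by (auto simp: complex_nonpos_Reals_iff)
  then have "((\<lambda>x. (x / 2) powr \<nu>) has_field_derivative \<nu> * (z / 2) powr (\<nu> - 1) * (1 / 2)) (at z)"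
    by (auto intro!: derivative_eq_intros has_field_derivative_powr)
  also have "\<nu> * (z / 2) powr (\<nu> - 1) * (1 / 2) = \<nu> * (z / 2) powr \<nu> / z"
    using z by (simp add: powr_diff)
  finally show ?thesis .
qed

text \<open>The function is x (I(\<nu>) K(\<nu>+1) + I(\<nu>+1) K(\<nu>)) with the power of
  \<open>x / 2\<close> pulled out.\<close>

lemma bessel_IK_wronskian_derivative:
  assumes "Re x > 0"
  shows "((\<lambda>x. x * (x / 2) powr \<nu> * (bessel_series \<nu> (x\<^sup>2 / 4) * bessel_K (\<nu> + 1) x
      + (x / 2) * bessel_series (\<nu> + 1) (x\<^sup>2 / 4) * bessel_K \<nu> x)) has_field_derivative 0) (at x)"
proof -
  have x0: "x \<noteq> 0" using assms by auto
  have slit: "x \<notin> \<real>\<^sub>\<le>\<^sub>0" using assms by (auto simp: complex_nonpos_Reals_iff)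
  define p where "p = (x / 2) powr \<nu>"
  have dp: "((\<lambda>x. (x / 2) powr \<nu>) has_field_derivative \<nu> * p / x) (at x)"
    unfolding p_def by (rule DERIV_half_powr) (use slit in simp)
  have dT: "((\<lambda>x. bessel_series \<mu> (x\<^sup>2 / 4)) has_field_derivative bessel_series (\<mu> + 1) (x\<^sup>2 / 4) * (x / 2)) (at x)" for \<mu>
    by (rule DERIV_chain2[OF DERIV_bessel_series]) (auto intro!: derivative_eq_intros)
  have r0: "bessel_series \<nu> (x\<^sup>2 / 4) = (\<nu> + 1) * bessel_series (\<nu> + 1) (x\<^sup>2 / 4) + x\<^sup>2 / 4 * bessel_series (\<nu> + 1 + 1) (x\<^sup>2 / 4)"
    using bessel_series_recurrence[of "\<nu> + 1" "x\<^sup>2 / 4"] by simp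
  have k1: "bessel_K (\<nu> - 1) x = bessel_K (\<nu> + 1) x - 2 * \<nu> / x * bessel_K \<nu> x"
    using bessel_K_recurrence[OF assms, of \<nu>] x0 by (simp add: field_simps)
  have k2: "bessel_K (\<nu> + 1 + 1) x = bessel_K \<nu> x + 2 * (\<nu> + 1) / x * bessel_K (\<nu> + 1) x"
    using bessel_K_recurrence[OF assms, of "\<nu> + 1"] x0 by (simp add: field_simps)
  have dK: "(bessel_K \<nu> has_field_derivative - bessel_K (\<nu> + 1) x + \<nu> / x * bessel_K \<nu> x) (at x)"
  proof -
    have "- (bessel_K (\<nu> - 1) x + bessel_K (\<nu> + 1) x) / 2 = - bessel_K (\<nu> + 1) x + \<nu> / x * bessel_K \<nu> x"
      unfolding k1 using x0 by (simp add: field_simps)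
    then show ?thesis using DERIV_bessel_K[OF assms, of \<nu>] by (simp only:)
  qed
  have dK1: "(bessel_K (\<nu> + 1) has_field_derivative - bessel_K \<nu> x - (\<nu> + 1) / x * bessel_K (\<nu> + 1) x) (at x)"
  proof -
    have "- (bessel_K (\<nu> + 1 - 1) x + bessel_K (\<nu> + 1 + 1) x) / 2 = - bessel_K \<nu> x - (\<nu> + 1) / x * bessel_K (\<nu> + 1) x"
      unfolding k2 using x0 by (simp add: field_simps)
    then show ?thesis using DERIV_bessel_K[OF assms, of "\<nu> + 1"] by (simp only:)
  qed
  define S0 S1 S2 K0 K1 where S: "S0 = bessel_series \<nu> (x\<^sup>2 / 4)" "S1 = bessel_series (\<nu> + 1) (x\<^sup>2 / 4)"
      "S2 = bessel_series (\<nu> + 1 + 1) (x\<^sup>2 / 4)" "K0 = bessel_K \<nu> x" "K1 = bessel_K (\<nu> + 1) x"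
  have D: "((\<lambda>x. x * (x / 2) powr \<nu> * (bessel_series \<nu> (x\<^sup>2 / 4) * bessel_K (\<nu> + 1) x
      + (x / 2) * bessel_series (\<nu> + 1) (x\<^sup>2 / 4) * bessel_K \<nu> x)) has_field_derivative
      (x * p) * ((S0 * (- K0 - (\<nu> + 1) / x * K1) + (S1 * (x / 2)) * K1)
        + ((x / 2 * S1) * (- K1 + \<nu> / x * K0) + (x / 2 * (S2 * (x / 2)) + 1 / 2 * S1) * K0))
      + (x * (\<nu> * p / x) + 1 * p) * (S0 * K1 + x / 2 * S1 * K0)) (at x)"
    using dT[of "\<nu> + 1"] unfolding S p_def
    by (intro DERIV_mult' DERIV_add DERIV_ident dK dK1 dT dp[unfolded p_def] DERIV_cdivide)
  \<comment> \<open>After the recurrences for \<open>K\<close> only multiples of \<open>K0\<close>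
    survive, and their coefficient is the recurrence of the series.\<close>
  have "(x * p) * ((S0 * (- K0 - (\<nu> + 1) / x * K1) + (S1 * (x / 2)) * K1)
        + ((x / 2 * S1) * (- K1 + \<nu> / x * K0) + (x / 2 * (S2 * (x / 2)) + 1 / 2 * S1) * K0))
      + (x * (\<nu> * p / x) + 1 * p) * (S0 * K1 + x / 2 * S1 * K0)
      = x * p * K0 * ((\<nu> + 1) * S1 + x\<^sup>2 / 4 * S2 - S0)"
    using x0 by (simp add: field_simps power2_eq_square)
  also have "\<dots> = 0" using r0 by (simp add: S)
  finally show ?thesis using D by simp
qed

lemma bessel_IK_wronskian:
  fixes \<nu> :: real and x :: complex
  assumes x: "Re x > 0" and \<nu>: "\<nu> > - 1" "\<nu> \<noteq> 0"
  shows "x * (x / 2) powr \<nu> * (bessel_series \<nu> (x\<^sup>2 / 4) * bessel_K (\<nu> + 1) x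
      + (x / 2) * bessel_series (\<nu> + 1) (x\<^sup>2 / 4) * bessel_K \<nu> x) = 1"
proof -
  define G where "G x = x * (x / 2) powr \<nu> * (bessel_series \<nu> (x\<^sup>2 / 4) * bessel_K (\<nu> + 1) x
      + (x / 2) * bessel_series (\<nu> + 1) (x\<^sup>2 / 4) * bessel_K \<nu> x)" for x :: complex
  have "\<exists>c. \<forall>x\<in>{x. Re x > 0}. G x = c"
    using bessel_IK_wronskian_derivative[of _ \<nu>] unfolding G_def
    by (intro has_field_derivative_zero_constant convex_halfspace_Re_gt) (auto intro: has_field_derivative_at_within)
  then obtain c where c: "\<And>x. Re x > 0 \<Longrightarrow> G x = c" by blast
  define k where "k l r = (of_real r / 2) powr of_real l * bessel_K (of_real l) (of_real r)" for l r :: real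
  define S where "S l r = bessel_series l ((of_real r)\<^sup>2 / 4)" for l and r :: real
  have K: "(k l \<longlongrightarrow> Gamma (of_real l) / 2) (at_right 0)" if "l > 0" for l
    unfolding k_def using that by (rule bessel_K_asymptotic_0)
  have Slim: "(S l \<longlongrightarrow> rGamma (l + 1)) (at_right 0)" for l
  proof -
    have "isCont (S l) 0" unfolding S_def
      by (rule continuous_on_interior[of UNIV]) (auto intro!: continuous_intros)
    then have "(S l \<longlongrightarrow> S l 0) (at_right 0)" unfolding isCont_def by (rule tendsto_within_subset) auto
    then show ?thesis by (simp add: S_def bessel_series_0)
  qed
  \<comment> \<open>The second summand carries the power \<nu> + 2. Of this, |\<nu>| is spent on the
    limit of \<open>K\<close> at order |\<nu>|, which equals \<open>K\<close> at order \<nu>; the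
    excess \<open>m\<close> is positive since \<nu> > -1, and it forces the limit 0.\<close>
  define m where "m = \<nu> + 2 - \<bar>\<nu>\<bar>"
  have m: "m > 0" using \<nu> by (auto simp: m_def)
  have eq: "G (of_real r) = 2 * S \<nu> r * k (\<nu> + 1) r + 2 * of_real ((r / 2) powr m) * S (\<nu> + 1) r * k \<bar>\<nu>\<bar> r" if r: "r > 0" for r
  proof -
    have nz: "(of_real r / 2 :: complex) \<noteq> 0" using r by simp
    have p1: "of_real r * (of_real r / 2 :: complex) powr \<nu> = 2 * (of_real r / 2) powr (of_real (\<nu> + 1))"
      using nz by (simp add: powr_add)
    have p2: "of_real r * (of_real r / 2 :: complex) powr \<nu> * (of_real r / 2) = 2 * of_real ((r / 2) powr m) * (of_real r / 2) powr (of_real \<bar>\<nu>\<bar>)"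
    proof -
      have "of_real ((r / 2) powr m) = (of_real r / 2 :: complex) powr (of_real m)"
        using r by (simp add: powr_of_real[symmetric])
      then have "of_real ((r / 2) powr m) * (of_real r / 2) powr (of_real \<bar>\<nu>\<bar>) = (of_real r / 2 :: complex) powr (of_real (\<nu> + 2))"
        by (simp add: powr_add[symmetric] m_def flip: of_real_add)
      also have "\<dots> = (of_real r / 2 :: complex) powr \<nu> * (of_real r / 2)\<^sup>2"
      proof -
        have pr: "(of_real r / 2 :: complex) powr of_real y = of_real ((r / 2) powr y)" for y
          using powr_of_real[of "r / 2" y] r by simp
        have "(r / 2) powr (\<nu> + 2) = (r / 2) powr \<nu> * (r / 2)\<^sup>2"
          using r by (simp only: powr_add) (simp add: powr_numeral)
        then show ?thesis unfolding pr by simp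
      qed
      finally show ?thesis by (simp add: power2_eq_square field_simps)
    qed
    have K: "bessel_K (of_real \<bar>\<nu>\<bar>) x = bessel_K (of_real \<nu>) x" for x
      by (simp add: abs_if bessel_K_minus)
    have "G (of_real r) = (of_real r * (of_real r / 2 :: complex) powr \<nu>) * S \<nu> r * bessel_K (\<nu> + 1) (of_real r)
        + (of_real r * (of_real r / 2 :: complex) powr \<nu> * (of_real r / 2)) * S (\<nu> + 1) r * bessel_K \<nu> (of_real r)"
      by (simp add: G_def S_def algebra_simps)
    then show ?thesis unfolding p2 unfolding p1 by (simp add: k_def K algebra_simps)
  qed
  have "((\<lambda>r. 2 * S \<nu> r * k (\<nu> + 1) r + 2 * of_real ((r / 2) powr m) * S (\<nu> + 1) r * k \<bar>\<nu>\<bar> r) \<longlongrightarrow>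
      2 * rGamma (of_real \<nu> + 1) * (Gamma (of_real (\<nu> + 1)) / 2)
      + 2 * of_real ((0 / 2) powr m) * rGamma (of_real (\<nu> + 1) + 1) * (Gamma (of_real \<bar>\<nu>\<bar>) / 2)) (at_right 0)"
    using \<nu> m by (intro tendsto_intros Slim K) (auto intro: eventually_mono[OF eventually_at_right_less])
  also have "2 * rGamma (of_real \<nu> + 1) * (Gamma (of_real (\<nu> + 1)) / 2)
      + 2 * of_real ((0 / 2) powr m) * rGamma (of_real (\<nu> + 1) + 1) * (Gamma (of_real \<bar>\<nu>\<bar>) / 2) = (1 :: complex)"
  proof -
    have "Gamma (of_real (\<nu> + 1)) \<noteq> (0::complex)"
    proof -
      have "Gamma (\<nu> + 1) > 0" by (rule Gamma_real_pos) (use \<nu> in simp)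
      then have "complex_of_real (Gamma (\<nu> + 1)) \<noteq> 0" by simp
      then show ?thesis unfolding Gamma_complex_of_real .
    qed
    then show ?thesis using m by (simp add: rGamma_inverse_Gamma)
  qed
  finally have "((\<lambda>r. G (of_real r)) \<longlongrightarrow> 1) (at_right 0)"
    by (rule Lim_transform_eventually) (use eq in \<open>auto intro!: eventually_at_rightI[of 0 1]\<close>)
  moreover have "((\<lambda>r. G (of_real r)) \<longlongrightarrow> c) (at_right 0)"
    by (rule Lim_transform_eventually[OF tendsto_const]) (use c in \<open>auto intro!: eventually_at_rightI[of 0 1]\<close>)
  ultimately have "c = 1" using tendsto_unique trivial_limit_at_right_real by blast
  then show ?thesis using c[OF x] by (simp add: G_def)
qed

lemma sin_pi_of_real_nonzero:
  assumes "0 < \<nu>" "\<nu> < 1"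
  shows "sin (of_real pi * complex_of_real \<nu>) \<noteq> 0"
proof -
  have "sin (pi * \<nu>) > 0" using assms by (intro sin_gt_zero) auto
  then show ?thesis by (simp flip: of_real_mult add: sin_of_real)
qed

text \<open>The Wronskian relations at \<nu> and -\<nu>, the first rewritten by the recurrences and
  the second by the symmetry of \<open>K\<close> in the order, are two linear equations in
  \<open>K\<close> at orders \<nu> and \<nu> - 1. Their determinant is
  \<open>bessel_series_wronskian\<close>.\<close>

lemma bessel_K_eq_bessel_I:
  fixes \<nu> :: real and x :: complex
  assumes x: "Re x > 0" and \<nu>: "0 < \<nu>" "\<nu> < 1"
  shows "bessel_K \<nu> x = of_real pi / 2 * (bessel_I (- \<nu>) x - bessel_I \<nu> x) / sin (of_real pi * complex_of_real \<nu>)"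
proof -
  define a T1 T2 T3 T4 k0 k1 where defs: "a = (x / 2) powr \<nu>"
    "T1 = bessel_series \<nu> (x\<^sup>2 / 4)" "T2 = bessel_series (of_real \<nu> - 1) (x\<^sup>2 / 4)"
    "T3 = bessel_series (- of_real \<nu>) (x\<^sup>2 / 4)" "T4 = bessel_series (1 - of_real \<nu>) (x\<^sup>2 / 4)"
    "k0 = bessel_K \<nu> x" "k1 = bessel_K (of_real \<nu> - 1) x"
  have x0: "x \<noteq> 0" using x by auto
  have a0: "a \<noteq> 0" using x0 by (simp add: defs)
  have ai: "(x / 2) powr (- \<nu>) = 1 / a" unfolding defs(1) by (simp only: of_real_minus powr_minus inverse_eq_divide)
  have e1: "x * a * (T1 * k1 + (2 / x) * T2 * k0) = 1"
  proof -
    have r: "T2 = \<nu> * T1 + x\<^sup>2 / 4 * bessel_series (of_real \<nu> + 1) (x\<^sup>2 / 4)"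
      unfolding defs by (rule bessel_series_recurrence)
    have k: "bessel_K (of_real \<nu> + 1) x = k1 + 2 * \<nu> / x * k0"
      using bessel_K_recurrence[OF x, of \<nu>] x0 by (simp add: defs field_simps)
    have "T1 * bessel_K (of_real \<nu> + 1) x + (x / 2) * bessel_series (of_real \<nu> + 1) (x\<^sup>2 / 4) * k0 = T1 * k1 + (2 / x) * T2 * k0"
      unfolding r k using x0 by (simp add: field_simps power2_eq_square)
    then show ?thesis using bessel_IK_wronskian[OF x, of \<nu>] \<nu> by (simp add: defs)
  qed
  have e2: "x / a * (T3 * k1 + (x / 2) * T4 * k0) = 1"
  proof -
    have "bessel_K (1 - of_real \<nu>) x = k1" using bessel_K_minus[of "of_real \<nu> - 1" x] by (simp add: defs)
    moreover have "bessel_K (- of_real \<nu>) x = k0" by (simp add: defs bessel_K_minus)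
    ultimately show ?thesis using bessel_IK_wronskian[OF x, of "- \<nu>"] \<nu> ai by (simp add: defs)
  qed
  have w: "T3 * T2 - x\<^sup>2 / 4 * T1 * T4 = sin (of_real pi * complex_of_real \<nu>) / complex_of_real pi"
    unfolding defs by (rule bessel_series_wronskian)
  have f1: "x * (T1 * k1 + (2 / x) * T2 * k0) = 1 / a"
  proof -
    have "x * X = 1 / a" if "x * a * X = 1" for X using that a0 by (simp add: field_simps)
    from this[OF e1] show ?thesis .
  qed
  have f2: "x * (T3 * k1 + (x / 2) * T4 * k0) = a"
  proof -
    have "x * X = a" if "x / a * X = 1" for X using that a0 by (simp add: field_simps)
    from this[OF e2] show ?thesis .
  qed
  \<comment> \<open>Cramer's rule: \<open>T3\<close> times the first equation minus
    \<open>T1\<close> times the second eliminates \<open>k1\<close>.\<close>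
  have "2 * (T3 * T2 - x\<^sup>2 / 4 * T1 * T4) * k0 * x
      = x * (T3 * (x * (T1 * k1 + (2 / x) * T2 * k0)) - T1 * (x * (T3 * k1 + (x / 2) * T4 * k0)))"
    using x0 by (simp add: field_simps power2_eq_square)
  also have "\<dots> = x * (T3 / a - T1 * a)"
    unfolding f1 f2 by simp
  finally have main: "2 * (sin (of_real pi * complex_of_real \<nu>) / complex_of_real pi) * k0 = T3 / a - T1 * a"
    using x0 unfolding w by (metis mult.commute mult_cancel_left)
  have "sin (of_real pi * complex_of_real \<nu>) \<noteq> 0"
    using \<nu> by (rule sin_pi_of_real_nonzero)
  moreover have "bessel_I (- \<nu>) x - bessel_I \<nu> x = T3 / a - T1 * a"
    unfolding bessel_I_def ai by (simp add: defs)
  ultimately show ?thesis unfolding main[symmetric] by (simp add: defs field_simps)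
qed

section \<open>The square of K and a bound in the half-plane\<close>

lemma bessel_K_square:
  assumes "Re x > 0"
  shows "integrable lborel (\<lambda>q. bessel_K (2 * \<mu>) (2 * x * of_real (cosh q)))" (is ?int)
    and "(\<integral>q. bessel_K (2 * \<mu>) (2 * x * of_real (cosh q)) \<partial>lborel) = (bessel_K \<mu> x)\<^sup>2" (is ?eq)
proof -
  define k where "k = K_kernel \<mu> x"
  have k: "integrable lborel k" unfolding k_def by (rule integrable_K_kernel[OF assms])
  have km: "k \<in> borel_measurable borel" unfolding k_def by simp
  \<comment> \<open>With \<open>s = p - q\<close> the other argument \<open>s + 2 * q\<close> is
    \<open>p + q\<close>. The rotation thus splits into a one-dimensional affine substitution on
    each side of a Fubini swap, and the factor 2 is its Jacobian.\<close>
  define f where "f p = (case p of (s, q) \<Rightarrow> k s * k (s + 2 * q))" for p :: "real \<times> real"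
  have fm: "f \<in> borel_measurable (lborel \<Otimes>\<^sub>M lborel)"
    unfolding f_def using km by measurable
  have aff: "integrable lborel (\<lambda>q. k (s + 2 * q))" "(\<integral>q. k (s + 2 * q) \<partial>lborel) = (\<integral>t. k t \<partial>lborel) / 2" for s
    using lborel_integrable_real_affine[OF k, of 2 s] lborel_integral_real_affine[of 2 k s] by (simp_all add: scaleR_conv_of_real)
  have affn: "(\<integral>q. norm (k (s + 2 * q)) \<partial>lborel) = (\<integral>t. norm (k t) \<partial>lborel) / 2" for s
    using lborel_integral_real_affine[of 2 "\<lambda>t. norm (k t)" s] by simp
  have fI: "integrable (lborel \<Otimes>\<^sub>M lborel) f"
  proof (rule lborel_pair.Fubini_integrable[OF fm])
    show "integrable lborel (\<lambda>s. \<integral>q. norm (f (s, q)) \<partial>lborel)"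
      using k by (simp add: f_def norm_mult affn)
    show "AE s in lborel. integrable lborel (\<lambda>q. f (s, q))"
      using aff by (simp add: f_def)
  qed
  have inner: "(\<integral>s. f (s, q) \<partial>lborel) = 2 * bessel_K (2 * \<mu>) (2 * x * of_real (cosh q))" for q
  proof -
    have "(\<integral>s. f (s, q) \<partial>lborel) = (\<integral>p. f (- q + 1 * p, q) \<partial>lborel)"
      using lborel_integral_real_affine[of 1 "\<lambda>s. f (s, q)" "- q"] by simp
    also have "(\<lambda>p. f (- q + 1 * p, q)) = K_kernel (2 * \<mu>) (2 * x * of_real (cosh q))"
    proof
      fix p
      have c: "cosh (p - q) + cosh (p + q) = 2 * cosh q * cosh p" by (simp add: cosh_add cosh_diff)
      have "f (- q + 1 * p, q) = K_kernel \<mu> x (p - q) * K_kernel \<mu> x (p + q)"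
        by (simp add: f_def k_def algebra_simps)
      also have "\<dots> = exp (- (x * of_real (cosh (p - q) + cosh (p + q))) - 2 * \<mu> * of_real p)"
        by (simp add: K_kernel_def algebra_simps flip: exp_add)
      also have "\<dots> = K_kernel (2 * \<mu>) (2 * x * of_real (cosh q)) p"
        unfolding c by (simp add: K_kernel_def algebra_simps)
      finally show "f (- q + 1 * p, q) = K_kernel (2 * \<mu>) (2 * x * of_real (cosh q)) p" .
    qed
    finally show ?thesis by (simp add: bessel_K_def)
  qed
  have "integrable lborel (\<lambda>q. \<integral>s. f (s, q) \<partial>lborel)"
    by (rule lborel_pair.integrable_snd[of "\<lambda>s q. f (s, q)"]) (use fI in simp)
  then have "integrable lborel (\<lambda>q. (\<integral>s. f (s, q) \<partial>lborel) / 2)" by simp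
  then show ?int unfolding inner by simp
  have "2 * (\<integral>q. bessel_K (2 * \<mu>) (2 * x * of_real (cosh q)) \<partial>lborel) = (\<integral>q. \<integral>s. f (s, q) \<partial>lborel \<partial>lborel)"
    unfolding inner by simp
  also have "\<dots> = (\<integral>s. \<integral>q. f (s, q) \<partial>lborel \<partial>lborel)"
    by (rule lborel_pair.Fubini_integral[of "\<lambda>s q. f (s, q)"]) (use fI in simp)
  also have "\<dots> = (\<integral>s. k s * ((\<integral>t. k t \<partial>lborel) / 2) \<partial>lborel)"
    by (simp add: f_def aff)
  also have "\<dots> = 2 * (bessel_K \<mu> x)\<^sup>2"
    using k by (simp add: bessel_K_def k_def power2_eq_square)
  finally show ?eq by simp
qed

text \<open>Integration by parts against the derivative \<open>- x sinh t * e t\<close> of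
  \<open>e\<close> gains the factor 1/|x|. As \<nu> \<le> 1, the quotient \<phi> decreases, so the
  remaining integral is at most (\<phi>(T) - \<phi>(R)) / |x|, and with the boundary terms the sum
  is 2 \<phi>(T) / |x|, free of R. Of the exponential only \<open>norm (e t)\<close> \<le> 1 is
  used, so nothing degrades near the imaginary axis.\<close>

lemma norm_integral_cosh_tail_le:
  fixes \<nu> :: real
  assumes \<nu>: "0 \<le> \<nu>" "\<nu> \<le> 1" and x: "Re x \<ge> 0" "x \<noteq> 0" and T: "0 < T" "T \<le> R"
  shows "norm (integral {T..R} (\<lambda>t. exp (- (x * of_real (cosh t))) * of_real (cosh (\<nu> * t))))
    \<le> 2 * (cosh (\<nu> * T) / sinh T) / norm x"
proof -
  define e where "e t = exp (- (x * of_real (cosh t)))" for t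
  define \<phi> where "\<phi> t = cosh (\<nu> * t) / sinh t" for t
  define \<phi>' where "\<phi>' t = (\<nu> * sinh (\<nu> * t) * sinh t - cosh (\<nu> * t) * cosh t) / (sinh t)\<^sup>2" for t
  define \<Psi> where "\<Psi> t = - e t * of_real (\<phi> t) / x" for t
  have ne: "norm (e t) \<le> 1" for t using x by (simp add: e_def)
  have d\<phi>: "(\<phi> has_real_derivative \<phi>' t) (at t within S)" if "t > 0" for t S
    unfolding \<phi>_def \<phi>'_def using that
    by (auto intro!: derivative_eq_intros simp: power2_eq_square algebra_simps)
  have neg: "\<phi>' t \<le> 0" if "t > 0" for t
  proof -
    have "\<nu> * sinh (\<nu> * t) \<le> 1 * cosh (\<nu> * t)"
      using \<nu> that by (intro mult_mono sinh_le_cosh_real) auto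
    then have "\<nu> * sinh (\<nu> * t) * sinh t \<le> cosh (\<nu> * t) * cosh t"
      using that by (intro mult_mono sinh_le_cosh_real) auto
    then show ?thesis by (simp add: \<phi>'_def divide_nonpos_nonneg)
  qed
  have d\<Psi>: "(\<Psi> has_vector_derivative e t * of_real (cosh (\<nu> * t)) - e t * of_real (\<phi>' t) / x) (at t within S)" if "t > 0" for t S
  proof -
    have de: "(e has_vector_derivative - (x * of_real (sinh t)) * e t) (at t within S)"
      unfolding e_def
      by (rule has_vector_derivative_at_within,
          rule field_vector_diff_chain_at[where f = "\<lambda>t. - (x * of_real (cosh t))" and g = exp, unfolded o_def])
         (auto intro!: derivative_eq_intros)
    have d: "((\<lambda>t. complex_of_real (\<phi> t)) has_vector_derivative of_real (\<phi>' t)) (at t within S)"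
      using d\<phi>[OF that] by (auto simp: has_real_derivative_iff_has_vector_derivative intro: has_vector_derivative_of_real)
    have "((\<lambda>t. e t * of_real (\<phi> t)) has_vector_derivative e t * of_real (\<phi>' t) + - (x * of_real (sinh t)) * e t * of_real (\<phi> t)) (at t within S)"
      by (rule has_vector_derivative_mult[OF de d])
    then have "((\<lambda>t. (- 1 / x) * (e t * of_real (\<phi> t))) has_vector_derivative
        (- 1 / x) * (e t * of_real (\<phi>' t) + - (x * of_real (sinh t)) * e t * of_real (\<phi> t))) (at t within S)"
      by (rule has_vector_derivative_mult_right)
    moreover have "(- 1 / x) * (e t * of_real (\<phi>' t) + - (x * of_real (sinh t)) * e t * of_real (\<phi> t))
        = e t * of_real (cosh (\<nu> * t)) - e t * of_real (\<phi>' t) / x"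
      using x that by (simp add: \<phi>_def field_simps)
    ultimately show ?thesis by (simp add: \<Psi>_def[abs_def])
  qed
  have I1: "((\<lambda>t. e t * of_real (cosh (\<nu> * t)) - e t * of_real (\<phi>' t) / x) has_integral \<Psi> R - \<Psi> T) {T..R}"
    by (rule fundamental_theorem_of_calculus[OF T(2)]) (use d\<Psi> T in auto)
  have I2: "((\<lambda>t. - \<phi>' t / norm x) has_integral (- \<phi> R / norm x) - (- \<phi> T / norm x)) {T..R}"
    by (rule fundamental_theorem_of_calculus[OF T(2)])
       (use d\<phi> T x in \<open>auto intro!: derivative_eq_intros simp flip: has_real_derivative_iff_has_vector_derivative\<close>)
  have c: "continuous_on {T..R} (\<lambda>t. e t * of_real (\<phi>' t) / x)"
    unfolding e_def \<phi>'_def using T x by (intro continuous_intros) auto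
  have "norm (integral {T..R} (\<lambda>t. e t * of_real (\<phi>' t) / x)) \<le> integral {T..R} (\<lambda>t. - \<phi>' t / norm x)"
  proof (rule integral_norm_bound_integral)
    show "(\<lambda>t. e t * of_real (\<phi>' t) / x) integrable_on {T..R}" by (rule integrable_continuous_real[OF c])
    show "(\<lambda>t. - \<phi>' t / norm x) integrable_on {T..R}" using I2 by (auto simp: integrable_on_def)
    show "norm (e t * of_real (\<phi>' t) / x) \<le> - \<phi>' t / norm x" if "t \<in> {T..R}" for t
    proof -
      have "norm (e t) * \<bar>\<phi>' t\<bar> \<le> 1 * \<bar>\<phi>' t\<bar>" by (intro mult_right_mono ne) auto
      then show ?thesis using neg[of t] that T by (simp add: norm_mult norm_divide divide_right_mono abs_of_nonpos)
    qed
  qed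
  then have b: "norm (integral {T..R} (\<lambda>t. e t * of_real (\<phi>' t) / x)) \<le> (\<phi> T - \<phi> R) / norm x"
    using integral_unique[OF I2] by (simp add: diff_divide_distrib)
  have n\<Psi>: "norm (\<Psi> t) \<le> \<phi> t / norm x" if "t > 0" for t
  proof -
    have "\<phi> t > 0" using that by (simp add: \<phi>_def)
    moreover have "norm (e t) * \<bar>\<phi> t\<bar> \<le> 1 * \<bar>\<phi> t\<bar>" by (intro mult_right_mono ne) auto
    ultimately show ?thesis by (simp add: \<Psi>_def norm_mult norm_divide divide_right_mono)
  qed
  have "integral {T..R} (\<lambda>t. e t * of_real (cosh (\<nu> * t)))
     = integral {T..R} (\<lambda>t. (e t * of_real (cosh (\<nu> * t)) - e t * of_real (\<phi>' t) / x) + e t * of_real (\<phi>' t) / x)"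
    by simp
  also have "\<dots> = (\<Psi> R - \<Psi> T) + integral {T..R} (\<lambda>t. e t * of_real (\<phi>' t) / x)"
    using I1 integrable_continuous_real[OF c] by (subst Henstock_Kurzweil_Integration.integral_add) (auto simp: has_integral_iff)
  also have "norm \<dots> \<le> (norm (\<Psi> R) + norm (\<Psi> T)) + norm (integral {T..R} (\<lambda>t. e t * of_real (\<phi>' t) / x))"
    by (intro order_trans[OF norm_triangle_ineq] add_right_mono norm_triangle_ineq4)
  also have "\<dots> \<le> (\<phi> R / norm x + \<phi> T / norm x) + (\<phi> T - \<phi> R) / norm x"
    using T by (intro add_mono n\<Psi> b) auto
  also have "\<dots> = 2 * (cosh (\<nu> * T) / sinh T) / norm x"
    by (simp add: \<phi>_def diff_divide_distrib)
  finally show ?thesis by (simp add: e_def)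
qed

text \<open>The integrand is symmetrized to an even one. The piece over \<open>[-T, T]\<close> is
  bounded by its length, the two tails by oscillation together with \<open>sinh T\<close> \<ge> T.
  The cut \<open>T\<close> stays free, to be chosen depending on |x|.\<close>

lemma norm_bessel_K_le_split:
  fixes \<nu> :: real
  assumes \<nu>: "0 \<le> \<nu>" "\<nu> \<le> 1" and x: "Re x > 0" and T: "0 < T" "T \<le> 1"
  shows "norm (bessel_K \<nu> x) \<le> cosh 1 * (T + 2 / (T * norm x))"
proof -
  define g where "g t = exp (- (x * of_real (cosh t))) * of_real (cosh (\<nu> * t))" for t
  have x0: "x \<noteq> 0" using x by auto
  have geq: "g t = (K_kernel \<nu> x t + K_kernel (- \<nu>) x t) / 2" for t
  proof -
    have k: "K_kernel \<mu> x t = exp (- (x * of_real (cosh t))) * exp (- (\<mu> * of_real t))" for \<mu>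
      by (simp add: K_kernel_def flip: exp_add)
    have c: "complex_of_real (cosh (\<nu> * t)) = (exp (- (of_real \<nu> * of_real t)) + exp (- (- of_real \<nu> * of_real t))) / 2"
      by (simp add: cosh_field_def flip: exp_of_real)
    show ?thesis unfolding g_def k c by (simp add: algebra_simps)
  qed
  have gI: "integrable lborel g"
    unfolding geq using integrable_K_kernel[OF x] by simp
  have Kg: "bessel_K \<nu> x = (\<integral>t. g t \<partial>lborel) / 2"
    unfolding geq using integrable_K_kernel[OF x] bessel_K_minus[of \<nu> x] by (simp add: bessel_K_def)
  have gc: "continuous_on A g" for A
    unfolding g_def cosh_def by (intro continuous_intros)
  have gint: "g integrable_on {a..b}" for a b by (rule integrable_continuous_real[OF gc])
  have geven: "g (- t) = g t" for t by (simp add: g_def)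
  define B where "B = 2 * (2 * (cosh 1 / T) / norm x) + cosh 1 * (T - - T)"
  have tail: "norm (integral {T..R} g) \<le> 2 * (cosh 1 / T) / norm x" if "R \<ge> T" for R
  proof -
    have "norm (integral {T..R} g) \<le> 2 * (cosh (\<nu> * T) / sinh T) / norm x"
      unfolding g_def using \<nu> x x0 T that by (intro norm_integral_cosh_tail_le) auto
    also have "\<dots> \<le> 2 * (cosh 1 / T) / norm x"
    proof -
      have "T \<le> sinh T" using real_le_x_sinh[of T] T by (simp add: sinh_field_def exp_minus)
      moreover have "cosh (\<nu> * T) \<le> cosh 1"
        using \<nu> T mult_mono[of \<nu> 1 T 1] by (subst cosh_real_nonneg_le_iff) auto
      ultimately show ?thesis using T by (intro divide_right_mono mult_left_mono frac_le) auto
    qed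
    finally show ?thesis .
  qed
  have bound: "norm (integral {-R..R} g) \<le> B" if "R \<ge> T" for R
  proof -
    have "integral {-R..R} g = integral {-R..-T} g + integral {-T..T} g + integral {T..R} g"
      using T that gint by (simp add: Henstock_Kurzweil_Integration.integral_combine)
    also have "integral {-R..-T} g = integral {T..R} g"
      using Henstock_Kurzweil_Integration.integral_reflect_real[of R T g] by (simp add: geven)
    finally have "norm (integral {-R..R} g) \<le> norm (integral {T..R} g) + norm (integral {-T..T} g) + norm (integral {T..R} g)"
      by (simp only:) (intro order_trans[OF norm_triangle_ineq] add_right_mono norm_triangle_ineq)
    moreover have "norm (integral {-T..T} g) \<le> cosh 1 * (T - - T)"
    proof (rule integral_bound)
      fix t assume t: "t \<in> {-T..T}"
      have "cosh (\<nu> * t) = cosh \<bar>\<nu> * t\<bar>" by (rule cosh_real_abs[symmetric])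
      also have "\<dots> \<le> cosh 1"
        using \<nu> t T mult_mono[of \<nu> 1 "\<bar>t\<bar>" 1] by (subst cosh_real_nonneg_le_iff) (auto simp: abs_mult)
      finally have "1 * cosh (\<nu> * t) \<le> 1 * cosh 1" by simp
      moreover have "norm (exp (- (x * of_real (cosh t)))) \<le> 1" using x by simp
      ultimately show "norm (g t) \<le> cosh 1"
        unfolding g_def norm_mult using mult_mono[of "norm (exp (- (x * of_real (cosh t))))" 1 "cosh (\<nu> * t)" "cosh 1"] by simp
    qed (use T gc in auto)
    ultimately show ?thesis using tail[OF that] unfolding B_def by linarith
  qed
  \<comment> \<open>The tails were estimated on finite intervals only; the bound \<open>B\<close>
    does not depend on the interval and so passes to the limit.\<close>
  have "(\<lambda>n. \<integral>t. indicator {- real n..real n} t *\<^sub>R g t \<partial>lborel) \<longlonglongrightarrow> (\<integral>t. g t \<partial>lborel)"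
  proof (rule integral_dominated_convergence)
    show "integrable lborel (\<lambda>t. norm (g t))" using gI by simp
    show "AE t in lborel. (\<lambda>n. indicator {- real n..real n} t *\<^sub>R g t) \<longlonglongrightarrow> g t"
    proof (intro AE_I2)
      fix t :: real
      obtain N where N: "real N \<ge> \<bar>t\<bar>" using real_arch_simple by blast
      have "\<forall>\<^sub>F n in sequentially. g t = indicator {- real n..real n} t *\<^sub>R g t"
        using eventually_ge_at_top[of N] by eventually_elim (use N in \<open>auto simp: indicator_def abs_le_iff\<close>)
      then show "(\<lambda>n. indicator {- real n..real n} t *\<^sub>R g t) \<longlonglongrightarrow> g t"
        by (rule Lim_transform_eventually[OF tendsto_const])
    qed
  qed (use gI in \<open>auto simp: indicator_def\<close>)
  moreover have "(\<integral>t. indicator {- real n..real n} t *\<^sub>R g t \<partial>lborel) = integral {- real n..real n} g" for n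
    using set_borel_integral_eq_integral(2)[OF borel_integrable_atLeastAtMost'[OF gc, of "- real n" "real n"]]
    by (simp add: set_lebesgue_integral_def)
  ultimately have lim: "(\<lambda>n. norm (integral {- real n..real n} g)) \<longlonglongrightarrow> norm (\<integral>t. g t \<partial>lborel)"
    by (simp add: tendsto_norm)
  have "norm (\<integral>t. g t \<partial>lborel) \<le> B"
  proof (rule LIMSEQ_le_const2[OF lim])
    show "\<exists>N. \<forall>n\<ge>N. norm (integral {- real n..real n} g) \<le> B"
      using T by (intro exI[of _ 1] allI impI bound) auto
  qed
  then have "norm (bessel_K \<nu> x) \<le> B / 2" by (simp add: Kg norm_divide)
  also have "B / 2 = cosh 1 * (T + 2 / (T * norm x))"
    using T x0 by (simp add: B_def field_simps)
  finally show ?thesis .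
qed

lemma norm_bessel_K_le_inverse_sqrt:
  fixes \<nu> r :: real
  assumes \<nu>: "0 \<le> \<nu>" "\<nu> \<le> 1" and "r > 0"
  obtains B where "\<And>x. Re x > 0 \<Longrightarrow> norm x \<ge> r \<Longrightarrow> norm (bessel_K \<nu> x) \<le> B / sqrt (norm x)"
proof -
  define s where "s = min r 1"
  have s: "0 < s" "s \<le> r" "s \<le> 1" using \<open>r > 0\<close> by (auto simp: s_def)
  show ?thesis
  proof (rule that[of "cosh 1 * (sqrt s + 2 / sqrt s)"])
    fix x :: complex assume x: "Re x > 0" "norm x \<ge> r"
    have n: "norm x > 0" "norm x \<ge> s" using x s by auto
    \<comment> \<open>A cut of size |x| powr (-1/2) balances \<open>T\<close> against
      \<open>1 / (T * norm x)\<close>; the factor \<open>sqrt s\<close> keeps it at most 1 for every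
      x with |x| \<ge> r.\<close>
    define T where "T = sqrt s / sqrt (norm x)"
    have T: "0 < T" "T \<le> 1" using n s by (auto simp: T_def)
    have "T * norm x = sqrt s * sqrt (norm x)"
      using n by (simp add: T_def field_simps)
    moreover have "c * (a / b + 2 / (a * b)) = c * (a + 2 / a) / b" if "a > 0" "b > 0" for a b c :: real
      using that by (simp add: field_simps)
    ultimately have "cosh 1 * (T + 2 / (T * norm x)) = cosh 1 * (sqrt s + 2 / sqrt s) / sqrt (norm x)"
      using n s(1) unfolding T_def by simp
    then show "norm (bessel_K \<nu> x) \<le> cosh 1 * (sqrt s + 2 / sqrt s) / sqrt (norm x)"
      using norm_bessel_K_le_split[OF \<nu> x(1) T] by simp
  qed
qed

section \<open>Passage to the imaginary axis\<close>

definition bessel_K_slit :: "complex \<Rightarrow> complex \<Rightarrow> complex" where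
  "bessel_K_slit \<nu> w = of_real pi / 2 * (bessel_I (- \<nu>) w - bessel_I \<nu> w) / sin (of_real pi * \<nu>)"

lemma continuous_on_bessel_I: "continuous_on (- \<real>\<^sub>\<le>\<^sub>0) (bessel_I \<nu>)"
proof -
  have "w / 2 \<in> - \<real>\<^sub>\<le>\<^sub>0" if "w \<in> - \<real>\<^sub>\<le>\<^sub>0" for w :: complex
    using that by (auto simp: complex_nonpos_Reals_iff)
  then show ?thesis unfolding bessel_I_def[abs_def]
    by (intro continuous_intros continuous_on_powr_complex) (auto simp: complex_nonpos_Reals_iff)
qed

lemma continuous_on_bessel_K_slit: "continuous_on (- \<real>\<^sub>\<le>\<^sub>0) (bessel_K_slit \<nu>)"
  unfolding bessel_K_slit_def[abs_def] divide_inverse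
  by (intro continuous_on_mult continuous_on_diff continuous_on_bessel_I continuous_on_const)

lemma bessel_K_slit_eq:
  fixes \<nu> :: real
  assumes "Re x > 0" "0 < \<nu>" "\<nu> < 1"
  shows "bessel_K_slit \<nu> x = bessel_K \<nu> x"
  using bessel_K_eq_bessel_I[OF assms] by (simp add: bessel_K_slit_def)

lemma cosh_ge_exp_half: "exp \<bar>q\<bar> / 2 \<le> cosh (q::real)"
  by (simp add: cosh_def abs_if)

lemma bessel_K_slit_square:
  fixes \<nu> :: real
  assumes \<nu>: "0 < \<nu>" "\<nu> < 1" and w: "Re w \<ge> 0" "w \<noteq> 0"
  shows "integrable lborel (\<lambda>q. bessel_K_slit \<nu> (2 * w * of_real (cosh q)))" (is ?int)
    and "(\<integral>q. bessel_K_slit \<nu> (2 * w * of_real (cosh q)) \<partial>lborel) = (bessel_K_slit (of_real \<nu> / 2) w)\<^sup>2" (is ?eq)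
proof -
  \<comment> \<open>The points \<open>W n\<close> approach \<open>w\<close> from the open half-plane
    without ever being closer to 0 than \<open>w\<close>, so a single constant \<open>B\<close>
    serves them all.\<close>
  define W where "W n = w + of_real (inverse (real (Suc n)))" for n
  have Wpos: "Re (W n) > 0" for n using w by (simp add: W_def add_nonneg_pos)
  have Wnorm: "norm (W n) \<ge> norm w" for n
  proof -
    have "(Re w)\<^sup>2 \<le> (Re (W n))\<^sup>2" using w by (intro power_mono) (auto simp: W_def)
    then show ?thesis by (simp add: cmod_def W_def del: of_nat_Suc)
  qed
  have Wlim: "W \<longlonglongrightarrow> w"
  proof -
    have "(\<lambda>n. w + of_real (inverse (real (Suc n)))) \<longlonglongrightarrow> w + of_real 0"
      by (intro tendsto_intros LIMSEQ_inverse_real_of_nat)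
    then show ?thesis by (simp add: W_def[abs_def])
  qed
  have slit: "u * of_real r \<in> - \<real>\<^sub>\<le>\<^sub>0" if "Re u \<ge> 0" "u \<noteq> 0" "r > 0" for u :: complex and r
    using that by (auto simp: complex_nonpos_Reals_iff complex_eq_iff mult_le_0_iff)
  have K_lim: "(\<lambda>n. bessel_K_slit \<mu> (W n * of_real r)) \<longlonglongrightarrow> bessel_K_slit \<mu> (w * of_real r)" if r: "r > 0" for \<mu> r
  proof (rule continuous_on_tendsto_compose[OF continuous_on_bessel_K_slit])
    show "(\<lambda>n. W n * of_real r) \<longlonglongrightarrow> w * of_real r" by (intro tendsto_intros Wlim)
    show "w * of_real r \<in> - \<real>\<^sub>\<le>\<^sub>0" using w r by (rule slit)
    have "W n * of_real r \<in> - \<real>\<^sub>\<le>\<^sub>0" for n using Wpos[of n] r by (intro slit) auto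
    then show "\<forall>\<^sub>F n in sequentially. W n * of_real r \<in> - \<real>\<^sub>\<le>\<^sub>0" by simp
  qed
  obtain B where B: "\<And>x. Re x > 0 \<Longrightarrow> norm x \<ge> 2 * norm w \<Longrightarrow> norm (bessel_K \<nu> x) \<le> B / sqrt (norm x)"
    using norm_bessel_K_le_inverse_sqrt[of \<nu> "2 * norm w"] \<nu> w by auto
  have Bnn: "B \<ge> 0"
  proof -
    have "norm (bessel_K \<nu> (of_real (2 * norm w))) \<le> B / sqrt (norm (of_real (2 * norm w) :: complex))"
      using w by (intro B) auto
    then have "0 \<le> B / sqrt (norm (of_real (2 * norm w) :: complex))" using norm_ge_zero order_trans by blast
    then show ?thesis using w by (simp add: zero_le_divide_iff)
  qed
  \<comment> \<open>This is \<open>B / sqrt (norm x)\<close> at \<open>x = 2 W cosh q\<close>,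
    estimated by \<open>2 cosh q\<close> \<ge> \<open>exp |q|\<close> and |W| \<ge> |w|: an
    integrable majorant independent of the distance to the axis.\<close>
  define D where "D q = B / sqrt (norm w) * exp (- \<bar>1 / 2 * q\<bar>)" for q :: real
  have D: "integrable lborel D"
    unfolding D_def using lborel_integrable_real_affine[OF integrable_exp_minus_abs, of "1 / 2" 0] by simp
  have Kb: "norm (bessel_K_slit \<nu> (W n * of_real (2 * cosh q))) \<le> D q" for n q
  proof -
    have R: "Re (W n * of_real (2 * cosh q)) > 0" using Wpos[of n] by simp
    have N: "norm (W n * of_real (2 * cosh q)) \<ge> norm w * exp \<bar>q\<bar>"
      unfolding norm_mult using Wnorm[of n] cosh_ge_exp_half[of q] by (intro mult_mono) auto
    have N1: "norm w * exp \<bar>q\<bar> > 0" using w by simp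
    have "norm (W n * of_real (2 * cosh q)) \<ge> norm w * 2"
      unfolding norm_mult using Wnorm[of n] cosh_real_ge_1[of q] by (intro mult_mono) auto
    then have "norm (bessel_K \<nu> (W n * of_real (2 * cosh q))) \<le> B / sqrt (norm (W n * of_real (2 * cosh q)))"
      by (intro B R) simp
    also have "\<dots> \<le> B / sqrt (norm w * exp \<bar>q\<bar>)"
      using N N1 Bnn by (intro divide_left_mono real_sqrt_le_mono mult_pos_pos) auto
    also have "\<dots> = D q"
    proof -
      have "sqrt (exp \<bar>q\<bar>) = exp (\<bar>q\<bar> / 2)"
        by (rule real_sqrt_unique) (simp_all add: power2_eq_square flip: exp_add)
      then show ?thesis by (simp add: D_def real_sqrt_mult exp_minus field_simps)
    qed
    finally show ?thesis using bessel_K_slit_eq[OF R \<nu>] by simp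
  qed
  have meas: "(\<lambda>q. bessel_K_slit \<nu> (u * of_real (2 * cosh q))) \<in> borel_measurable lborel" if "Re u \<ge> 0" "u \<noteq> 0" for u
  proof -
    have "continuous_on UNIV (\<lambda>q::real. bessel_K_slit \<nu> (u * of_real (2 * cosh q)))"
    proof (rule continuous_on_compose2[OF continuous_on_bessel_K_slit])
      show "(\<lambda>q::real. u * of_real (2 * cosh q)) ` UNIV \<subseteq> - \<real>\<^sub>\<le>\<^sub>0"
        by (intro image_subsetI slit[OF that]) simp
    qed (intro continuous_intros)
    then show ?thesis by (simp add: borel_measurable_continuous_onI)
  qed
  have ptw: "AE q in lborel. (\<lambda>n. bessel_K_slit \<nu> (W n * of_real (2 * cosh q))) \<longlonglongrightarrow> bessel_K_slit \<nu> (w * of_real (2 * cosh q))"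
    by (intro AE_I2 K_lim) simp
  have Wm: "(\<lambda>q. bessel_K_slit \<nu> (W n * of_real (2 * cosh q))) \<in> borel_measurable lborel" for n
    by (rule meas) (use Wpos[of n] in auto)
  have Kb': "AE q in lborel. norm (bessel_K_slit \<nu> (W n * of_real (2 * cosh q))) \<le> D q" for n using Kb by simp
  have int: "integrable lborel (\<lambda>q. bessel_K_slit \<nu> (w * of_real (2 * cosh q)))"
    and lim: "(\<lambda>n. \<integral>q. bessel_K_slit \<nu> (W n * of_real (2 * cosh q)) \<partial>lborel) \<longlonglongrightarrow> (\<integral>q. bessel_K_slit \<nu> (w * of_real (2 * cosh q)) \<partial>lborel)"
    using integrable_dominated_convergence[OF meas[OF w] Wm D ptw Kb'] integral_dominated_convergence[OF meas[OF w] Wm D ptw Kb'] by auto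
  have "(\<integral>q. bessel_K_slit \<nu> (W n * of_real (2 * cosh q)) \<partial>lborel) = (bessel_K_slit (of_real (\<nu> / 2)) (W n * of_real 1))\<^sup>2" for n
  proof -
    have "bessel_K_slit \<nu> (W n * of_real (2 * cosh q)) = bessel_K (2 * of_real (\<nu> / 2)) (2 * W n * of_real (cosh q))" for q
    proof -
      have "Re (W n * of_real (2 * cosh q)) > 0" using Wpos[of n] by simp
      from bessel_K_slit_eq[OF this \<nu>] show ?thesis by (simp add: mult_ac)
    qed
    then have "(\<integral>q. bessel_K_slit \<nu> (W n * of_real (2 * cosh q)) \<partial>lborel) = (bessel_K (of_real (\<nu> / 2)) (W n))\<^sup>2"
      using bessel_K_square(2)[OF Wpos[of n], of "of_real (\<nu> / 2)"] by simp
    also have "bessel_K (of_real (\<nu> / 2)) (W n) = bessel_K_slit (of_real (\<nu> / 2)) (W n)"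
      using bessel_K_slit_eq[OF Wpos[of n], of "\<nu> / 2"] \<nu> by simp
    finally show ?thesis by simp
  qed
  moreover have "(\<lambda>n. (bessel_K_slit (of_real (\<nu> / 2)) (W n * of_real 1))\<^sup>2) \<longlonglongrightarrow> (bessel_K_slit (of_real (\<nu> / 2)) (w * of_real 1))\<^sup>2"
    by (intro tendsto_intros K_lim) simp
  ultimately have "(\<integral>q. bessel_K_slit \<nu> (w * of_real (2 * cosh q)) \<partial>lborel) = (bessel_K_slit (of_real (\<nu> / 2)) (w * of_real 1))\<^sup>2"
    using lim LIMSEQ_unique by simp
  then show ?eq by (simp add: mult_ac)
  show ?int using int by (simp add: mult_ac)
qed

lemma bessel_I_imaginary:
  assumes "c > 0"
  shows "bessel_I \<nu> (\<i> * of_real c) = exp (\<i> * of_real pi * \<nu> / 2) * bessel_J \<nu> (of_real c)"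
    and "bessel_I \<nu> (- (\<i> * of_real c)) = exp (- (\<i> * of_real pi * \<nu> / 2)) * bessel_J \<nu> (of_real c)"
proof -
  have l1: "Ln (\<i> * of_real c / 2) = Ln (of_real c / 2) + \<i> * of_real pi / 2"
    using Ln_times_of_real[of "c / 2" \<i>] Ln_of_real[of "c / 2"] assms by (simp add: mult_ac)
  have l2: "Ln (- (\<i> * of_real c) / 2) = Ln (of_real c / 2) - \<i> * of_real pi / 2"
    using Ln_times_of_real[of "c / 2" "- \<i>"] Ln_of_real[of "c / 2"] assms by (simp add: mult_ac)
  define L where "L = Ln (complex_of_real c / 2)"
  have e1: "exp (\<nu> * (L + \<i> * of_real pi / 2)) = exp (\<i> * of_real pi * \<nu> / 2) * exp (\<nu> * L)"
    unfolding exp_add[symmetric] by (simp add: algebra_simps)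
  have e2: "exp (\<nu> * (L - \<i> * of_real pi / 2)) = exp (- (\<i> * of_real pi * \<nu> / 2)) * exp (\<nu> * L)"
    unfolding exp_add[symmetric] by (simp add: algebra_simps)
  have J: "bessel_J \<nu> (of_real c) = exp (\<nu> * L) * bessel_series \<nu> (- ((of_real c)\<^sup>2 / 4))"
    using assms unfolding bessel_J_eq_series powr_def L_def by simp
  show "bessel_I \<nu> (\<i> * of_real c) = exp (\<i> * of_real pi * \<nu> / 2) * bessel_J \<nu> (of_real c)"
    using assms unfolding bessel_I_def powr_def l1 L_def[symmetric] e1 J by (simp add: power_mult_distrib)
  show "bessel_I \<nu> (- (\<i> * of_real c)) = exp (- (\<i> * of_real pi * \<nu> / 2)) * bessel_J \<nu> (of_real c)"
    using assms unfolding bessel_I_def powr_def l2 L_def[symmetric] e2 J by (simp add: power_mult_distrib)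
qed

text \<open>In terms of \<open>E\<close> the rotation factors and the sine and cosine of \<pi>\<nu>
  are all rational, so later trigonometric identities become algebra in \<open>E\<close>.\<close>

lemma bessel_K_slit_imaginary:
  assumes "c > 0" and s: "sin (of_real pi * \<nu>) \<noteq> 0"
  defines "E \<equiv> exp (\<i> * of_real pi * \<nu> / 2)"
  shows "bessel_K_slit \<nu> (\<i> * of_real c) = of_real pi / 2 * (bessel_J (- \<nu>) (of_real c) / E - E * bessel_J \<nu> (of_real c)) / sin (of_real pi * \<nu>)"
    and "bessel_K_slit \<nu> (- (\<i> * of_real c)) = of_real pi / 2 * (E * bessel_J (- \<nu>) (of_real c) - bessel_J \<nu> (of_real c) / E) / sin (of_real pi * \<nu>)"
    and "sin (of_real pi * \<nu>) = (E\<^sup>2 - 1 / E\<^sup>2) / (2 * \<i>)" and "cos (of_real pi * \<nu>) = (E\<^sup>2 + 1 / E\<^sup>2) / 2"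
proof -
  have E0: "E \<noteq> 0" by (simp add: E_def)
  have "exp (\<i> * of_real pi * (- \<nu>) / 2) * E = 1" "exp (- (\<i> * of_real pi * \<nu> / 2)) * E = 1"
    unfolding E_def exp_add[symmetric] by simp_all
  then have m1: "exp (\<i> * of_real pi * (- \<nu>) / 2) = 1 / E" and m3: "exp (- (\<i> * of_real pi * \<nu> / 2)) = 1 / E"
    using E0 by (simp_all add: nonzero_eq_divide_eq)
  have m2: "exp (- (\<i> * of_real pi * (- \<nu>) / 2)) = E"
    by (simp add: E_def)
  show "bessel_K_slit \<nu> (\<i> * of_real c) = of_real pi / 2 * (bessel_J (- \<nu>) (of_real c) / E - E * bessel_J \<nu> (of_real c)) / sin (of_real pi * \<nu>)"
    unfolding bessel_K_slit_def bessel_I_imaginary[OF assms(1)] m1 m2 E_def[symmetric] m3 by simp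
  show "bessel_K_slit \<nu> (- (\<i> * of_real c)) = of_real pi / 2 * (E * bessel_J (- \<nu>) (of_real c) - bessel_J \<nu> (of_real c) / E) / sin (of_real pi * \<nu>)"
    unfolding bessel_K_slit_def bessel_I_imaginary[OF assms(1)] m1 m2 E_def[symmetric] m3 by simp
  have E2: "E\<^sup>2 = exp (\<i> * (of_real pi * \<nu>))"
    unfolding E_def power2_eq_square exp_add[symmetric] by (simp add: mult_ac)
  show "sin (of_real pi * \<nu>) = (E\<^sup>2 - 1 / E\<^sup>2) / (2 * \<i>)"
    unfolding E2 sin_exp_eq by (simp add: exp_minus inverse_eq_divide)
  show "cos (of_real pi * \<nu>) = (E\<^sup>2 + 1 / E\<^sup>2) / 2"
    unfolding E2 cos_exp_eq by (simp add: exp_minus inverse_eq_divide)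
qed

text \<open>The right-hand side is -\<pi> times \<open>J Y\<close> at order \<nu>/2 and argument
  c/2, with \<open>Y\<close> written out. The left-hand side inherits convergence from the two
  integrals of \<open>bessel_K_slit\<close> on the imaginary axis.\<close>

lemma bessel_J_cosh_integral:
  fixes \<nu> c :: real
  assumes \<nu>: "0 < \<nu>" "\<nu> < 1" and c: "c > 0"
  shows "integrable lborel (\<lambda>q. bessel_J \<nu> (of_real (c * cosh q)))" (is ?int)
    and "(\<integral>q. bessel_J \<nu> (of_real (c * cosh q)) \<partial>lborel) =
      of_real pi * bessel_J (of_real \<nu> / 2) (of_real c / 2) *
        (bessel_J (- (of_real \<nu> / 2)) (of_real c / 2) - bessel_J (of_real \<nu> / 2) (of_real c / 2) * cos (of_real pi * (of_real \<nu> / 2)))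
        / sin (of_real pi * (of_real \<nu> / 2))" (is ?eq)
proof -
  define \<mu> where "\<mu> = complex_of_real (\<nu> / 2)"
  define E where "E = exp (\<i> * of_real pi * of_real \<nu> / 2)"
  define G where "G = exp (\<i> * of_real pi * \<mu> / 2)"
  have EG: "E = G\<^sup>2" unfolding E_def G_def \<mu>_def power2_eq_square exp_add[symmetric] by (simp add: mult.assoc)
  have nz: "E \<noteq> 0" "G \<noteq> 0" by (simp_all add: E_def G_def)
  have s: "sin (of_real pi * complex_of_real \<nu>) \<noteq> 0" using \<nu> by (rule sin_pi_of_real_nonzero)
  have s': "sin (of_real pi * \<mu>) \<noteq> 0" unfolding \<mu>_def using \<nu> by (intro sin_pi_of_real_nonzero) auto
  have J: "bessel_J \<nu> (of_real r) = (bessel_K_slit \<nu> (- (\<i> * of_real r)) / E - E * bessel_K_slit \<nu> (\<i> * of_real r)) / (of_real pi * \<i>)" if "r > 0" for r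
  proof -
    define a b S where "a = bessel_J \<nu> (of_real r)" "b = bessel_J (- of_real \<nu>) (of_real r)" "S = sin (of_real pi * complex_of_real \<nu>)"
    have Kp: "bessel_K_slit \<nu> (\<i> * of_real r) = of_real pi / 2 * (b / E - E * a) / S"
      and Km: "bessel_K_slit \<nu> (- (\<i> * of_real r)) = of_real pi / 2 * (E * b - a / E) / S"
      and S: "S = (E\<^sup>2 - 1 / E\<^sup>2) / (2 * \<i>)"
      using bessel_K_slit_imaginary(1-3)[OF that s] by (simp_all add: a_b_S_def E_def)
    have S0: "S \<noteq> 0" using s by (simp add: a_b_S_def)
    have "bessel_K_slit \<nu> (- (\<i> * of_real r)) / E - E * bessel_K_slit \<nu> (\<i> * of_real r)
        = of_real pi / 2 * (a * (E\<^sup>2 - 1 / E\<^sup>2)) / S"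
      unfolding Kp Km using nz S0 by (simp add: field_simps power2_eq_square)
    also have "\<dots> = of_real pi * \<i> * a"
    proof -
      have "E\<^sup>2 - 1 / E\<^sup>2 = 2 * \<i> * S" by (simp add: S)
      then show ?thesis using S0 by simp
    qed
    finally show ?thesis by (simp add: a_b_S_def)
  qed
  have Jq: "bessel_J \<nu> (of_real (c * cosh q)) =
      (bessel_K_slit \<nu> (2 * (- (\<i> * of_real (c / 2))) * of_real (cosh q)) / E - E * bessel_K_slit \<nu> (2 * (\<i> * of_real (c / 2)) * of_real (cosh q))) / (of_real pi * \<i>)" for q
    using J[of "c * cosh q"] c by (simp add: mult_ac)
  have w: "Re (\<i> * of_real (c / 2)) \<ge> 0" "\<i> * of_real (c / 2) \<noteq> 0"
      "Re (- (\<i> * of_real (c / 2))) \<ge> 0" "- (\<i> * of_real (c / 2)) \<noteq> 0" using c by auto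
  note Ip = bessel_K_slit_square[OF \<nu> w(1,2)] and Im = bessel_K_slit_square[OF \<nu> w(3,4)]
  show ?int unfolding Jq using Ip(1) Im(1) by simp
  define a b S C where "a = bessel_J \<mu> (of_real c / 2)" "b = bessel_J (- \<mu>) (of_real c / 2)"
    "S = sin (of_real pi * \<mu>)" "C = cos (of_real pi * \<mu>)"
  have Kp: "bessel_K_slit \<mu> (\<i> * of_real (c / 2)) = of_real pi / 2 * (b / G - G * a) / S"
    and Km: "bessel_K_slit \<mu> (- (\<i> * of_real (c / 2))) = of_real pi / 2 * (G * b - a / G) / S"
    and S: "S = (G\<^sup>2 - 1 / G\<^sup>2) / (2 * \<i>)" and C: "C = (G\<^sup>2 + 1 / G\<^sup>2) / 2"
    using bessel_K_slit_imaginary[of "c / 2" \<mu>] c s' by (simp_all add: a_b_S_C_def G_def)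
  have S0: "S \<noteq> 0" using s' by (simp add: a_b_S_C_def)
  have "(\<integral>q. bessel_J \<nu> (of_real (c * cosh q)) \<partial>lborel)
      = ((bessel_K_slit \<mu> (- (\<i> * of_real (c / 2))))\<^sup>2 / E - E * (bessel_K_slit \<mu> (\<i> * of_real (c / 2)))\<^sup>2) / (of_real pi * \<i>)"
    unfolding Jq using Ip Im by (simp add: \<mu>_def)
  also have "\<dots> = of_real pi / (4 * \<i> * S\<^sup>2) * ((G * b - a / G)\<^sup>2 / G\<^sup>2 - G\<^sup>2 * (b / G - G * a)\<^sup>2)"
    unfolding Kp Km EG using nz S0 by (simp add: field_simps power2_eq_square)
  \<comment> \<open>The \<open>b^2\<close> terms, squares of \<open>J\<close> at order -\<mu>,
    cancel. This leaves a common factor \<open>a\<close> and hence a product of \<open>J\<close>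
    with \<open>Y\<close>.\<close>
  also have "(G * b - a / G)\<^sup>2 / G\<^sup>2 - G\<^sup>2 * (b / G - G * a)\<^sup>2
      = (G\<^sup>2 - 1 / G\<^sup>2) * (2 * a * b - a\<^sup>2 * (G\<^sup>2 + 1 / G\<^sup>2))"
    using nz by (simp add: field_simps power2_eq_square)
  also have "\<dots> = (2 * \<i> * S) * (2 * a * b - a\<^sup>2 * (2 * C))" by (simp add: S C)
  also have "of_real pi / (4 * \<i> * S\<^sup>2) * \<dots> = of_real pi * a * (b - a * C) / S"
    using S0 by (simp add: field_simps power2_eq_square)
  finally show ?eq by (simp add: a_b_S_C_def \<mu>_def)
qed

section \<open>Integrals along horizontal rays\<close>

lemma complex_slit_iff: "z \<in> - \<real>\<^sub>\<le>\<^sub>0 \<longleftrightarrow> Re z > 0 \<or> Im z \<noteq> 0"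
  by (auto simp: complex_nonpos_Reals_iff)

section \<open>Regularity, derivative and recurrence of \<open>bessel_J\<close>\<close>

lemma continuous_on_bessel_J [continuous_intros]:
  assumes "continuous_on A f" "continuous_on A g" "\<And>x. x \<in> A \<Longrightarrow> g x \<in> - \<real>\<^sub>\<le>\<^sub>0"
  shows "continuous_on A (\<lambda>x. bessel_J (f x) (g x))"
proof -
  have r: "Re (g x) > 0 \<or> Im (g x) \<noteq> 0" if "x \<in> A" for x
    using assms(3)[OF that] unfolding complex_slit_iff .
  have "A \<subseteq> {x. 0 \<le> Re (g x / 2) \<or> Im (g x / 2) \<noteq> 0}" using r by force
  moreover have "0 < Re (f x)" if "x \<in> A" "g x / 2 = 0" for x using r[OF that(1)] that(2) by simp
  ultimately show ?thesis
    unfolding bessel_J_eq_series by (intro continuous_intros continuous_on_powr_complex assms(1,2)) auto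
qed

lemma bessel_J_holomorphic_order [holomorphic_intros]:
  "f holomorphic_on A \<Longrightarrow> (\<lambda>\<nu>. bessel_J (f \<nu>) z) holomorphic_on A"
  unfolding bessel_J_eq_series by (intro holomorphic_intros)

lemma bessel_J_holomorphic [holomorphic_intros]:
  assumes "f holomorphic_on A" "\<And>z. z \<in> A \<Longrightarrow> f z \<in> - \<real>\<^sub>\<le>\<^sub>0"
  shows "(\<lambda>z. bessel_J \<nu> (f z)) holomorphic_on A"
  unfolding bessel_J_eq_series
  by (intro holomorphic_intros assms) (use assms(2) in \<open>force simp: complex_nonpos_Reals_iff\<close>)+

lemma DERIV_bessel_J:
  assumes z: "z \<in> - \<real>\<^sub>\<le>\<^sub>0"
  shows "(bessel_J \<nu> has_field_derivative \<nu> / z * bessel_J \<nu> z - bessel_J (\<nu> + 1) z) (at z)"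
proof -
  have z0: "z \<noteq> 0" using z by auto
  define p where "p = (z / 2) powr \<nu>"
  have dp: "((\<lambda>x. (x / 2) powr \<nu>) has_field_derivative \<nu> * p / z) (at z)"
    unfolding p_def by (rule DERIV_half_powr) (use z in simp)
  have dT: "((\<lambda>x. bessel_series \<nu> (- (x\<^sup>2 / 4))) has_field_derivative bessel_series (\<nu> + 1) (- (z\<^sup>2 / 4)) * (- (z / 2))) (at z)"
    by (rule DERIV_chain2[OF DERIV_bessel_series]) (auto intro!: derivative_eq_intros)
  have p1: "(z / 2) powr (\<nu> + 1) = p * (z / 2)" using z0 by (simp add: p_def powr_add)
  have "((\<lambda>x. (x / 2) powr \<nu> * bessel_series \<nu> (- (x\<^sup>2 / 4))) has_field_derivative
      p * (bessel_series (\<nu> + 1) (- (z\<^sup>2 / 4)) * (- (z / 2))) + \<nu> * p / z * bessel_series \<nu> (- (z\<^sup>2 / 4))) (at z)"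
    unfolding p_def by (intro DERIV_mult' dp[unfolded p_def] dT)
  moreover have "p * (bessel_series (\<nu> + 1) (- (z\<^sup>2 / 4)) * (- (z / 2))) + \<nu> * p / z * bessel_series \<nu> (- (z\<^sup>2 / 4))
      = \<nu> / z * bessel_J \<nu> z - bessel_J (\<nu> + 1) z"
    unfolding bessel_J_eq_series p1 by (simp add: p_def[symmetric] mult_ac)
  ultimately show ?thesis unfolding bessel_J_eq_series[abs_def] by simp
qed

lemma bessel_J_recurrence:
  assumes "z \<noteq> 0"
  shows "bessel_J (\<nu> + 2) z = 2 * (\<nu> + 1) / z * bessel_J (\<nu> + 1) z - bessel_J \<nu> z"
proof -
  have r: "bessel_series \<nu> (- (z\<^sup>2 / 4)) = (\<nu> + 1) * bessel_series (\<nu> + 1) (- (z\<^sup>2 / 4)) - z\<^sup>2 / 4 * bessel_series (\<nu> + 2) (- (z\<^sup>2 / 4))"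
    using bessel_series_recurrence[of "\<nu> + 1" "- (z\<^sup>2 / 4)"] by (simp add: add_ac)
  have p: "(z / 2) powr (\<nu> + 1) = (z / 2) powr \<nu> * (z / 2)" "(z / 2) powr (\<nu> + 2) = (z / 2) powr \<nu> * (z / 2)\<^sup>2"
    using assms by (simp_all add: powr_add powr_numeral)
  show ?thesis unfolding bessel_J_eq_series r p using assms by (simp add: field_simps power2_eq_square)
qed

text \<open>
  The function \<open>u = csqrt w * bessel_J \<nu> w\<close> satisfies \<open>u'' = - u + \<kappa> u\<close> with
  \<open>\<kappa> = (\<nu>\<^sup>2 - 1/4) / w\<^sup>2\<close>, which is integrable along a horizontal half-line, so the energy
  \<open>|u|\<^sup>2 + |u'|\<^sup>2\<close> stays bounded there by Gronwall.
\<close>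
lemma bessel_J_ray_energy:
  assumes ray: "\<And>s. s \<ge> 0 \<Longrightarrow> c + of_real s \<in> - \<real>\<^sub>\<le>\<^sub>0"
    and \<delta>: "\<delta> > 0" "\<And>s. s \<ge> 0 \<Longrightarrow> \<delta> * (1 + s) \<le> norm (c + of_real s)"
    and M: "norm (\<nu>\<^sup>2 - 1 / 4) \<le> M" and s: "s \<ge> 0"
  shows "norm (c + of_real s) * (norm (bessel_J \<nu> (c + of_real s)))\<^sup>2 \<le>
    norm c * ((norm (bessel_J \<nu> c))\<^sup>2 + (norm ((\<nu> + 1 / 2) / c * bessel_J \<nu> c - bessel_J (\<nu> + 1) c))\<^sup>2) * exp (M / \<delta>\<^sup>2)"
proof -
  define u where "u w = csqrt w * bessel_J \<nu> w" for w
  define v where "v w = csqrt w * ((\<nu> + 1 / 2) / w * bessel_J \<nu> w - bessel_J (\<nu> + 1) w)" for w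
  define \<kappa> where "\<kappa> w = (\<nu>\<^sup>2 - 1 / 4) / w\<^sup>2" for w :: complex
  have dr: "(csqrt has_field_derivative csqrt w / (2 * w)) (at w)" if "w \<in> - \<real>\<^sub>\<le>\<^sub>0" for w
  proof -
    have "inverse (2 * csqrt w) = csqrt w / (2 * w)"
      using that power2_csqrt[of w] by (cases "w = 0") (auto simp: field_simps power2_eq_square)
    then show ?thesis using has_field_derivative_csqrt[of w] that by simp
  qed
  have du: "(u has_field_derivative v w) (at w)" if w: "w \<in> - \<real>\<^sub>\<le>\<^sub>0" for w
  proof -
    have "(u has_field_derivative csqrt w * (\<nu> / w * bessel_J \<nu> w - bessel_J (\<nu> + 1) w) + csqrt w / (2 * w) * bessel_J \<nu> w) (at w)"
      unfolding u_def[abs_def] by (intro DERIV_mult' dr DERIV_bessel_J w)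
    moreover have "csqrt w * (\<nu> / w * bessel_J \<nu> w - bessel_J (\<nu> + 1) w) + csqrt w / (2 * w) * bessel_J \<nu> w = v w"
      using w by (cases "w = 0") (auto simp: v_def field_simps)
    ultimately show ?thesis by simp
  qed
  have dv: "(v has_field_derivative - u w + \<kappa> w * u w) (at w)" if w: "w \<in> - \<real>\<^sub>\<le>\<^sub>0" for w
  proof -
    have w0: "w \<noteq> 0" using w by auto
    have d1: "(bessel_J (\<nu> + 1) has_field_derivative bessel_J \<nu> w - (\<nu> + 1) / w * bessel_J (\<nu> + 1) w) (at w)"
    proof -
      have "(\<nu> + 1) / w * bessel_J (\<nu> + 1) w - bessel_J (\<nu> + 1 + 1) w = bessel_J \<nu> w - (\<nu> + 1) / w * bessel_J (\<nu> + 1) w"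
        using bessel_J_recurrence[OF w0, of \<nu>] w0 by (simp add: add.assoc)
      then show ?thesis using DERIV_bessel_J[OF w, of "\<nu> + 1"] by (simp only:)
    qed
    have dd: "((\<lambda>w. (\<nu> + 1 / 2) / w) has_field_derivative - ((\<nu> + 1 / 2) / w\<^sup>2)) (at w)"
    proof -
      have "((\<lambda>w. (\<nu> + 1 / 2) / w) has_field_derivative (0 * w - (\<nu> + 1 / 2) * 1) / (w * w)) (at w)"
        by (intro DERIV_divide DERIV_const DERIV_ident w0)
      then show ?thesis by (simp only: power2_eq_square mult_zero_left mult_1_right diff_0 minus_divide_left)
    qed
    have "(v has_field_derivative csqrt w * (((\<nu> + 1 / 2) / w * (\<nu> / w * bessel_J \<nu> w - bessel_J (\<nu> + 1) w)
          + - ((\<nu> + 1 / 2) / w\<^sup>2) * bessel_J \<nu> w) - (bessel_J \<nu> w - (\<nu> + 1) / w * bessel_J (\<nu> + 1) w))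
        + csqrt w / (2 * w) * ((\<nu> + 1 / 2) / w * bessel_J \<nu> w - bessel_J (\<nu> + 1) w)) (at w)"
      unfolding v_def[abs_def] by (intro DERIV_mult' DERIV_diff dr d1 dd DERIV_bessel_J w)
    moreover have "csqrt w * (((\<nu> + 1 / 2) / w * (\<nu> / w * bessel_J \<nu> w - bessel_J (\<nu> + 1) w)
          + - ((\<nu> + 1 / 2) / w\<^sup>2) * bessel_J \<nu> w) - (bessel_J \<nu> w - (\<nu> + 1) / w * bessel_J (\<nu> + 1) w))
        + csqrt w / (2 * w) * ((\<nu> + 1 / 2) / w * bessel_J \<nu> w - bessel_J (\<nu> + 1) w) = - u w + \<kappa> w * u w"
    proof -
      define k where "k = 1 / w"
      have k: "x / w = x * k" "x / w\<^sup>2 = x * k\<^sup>2" "x / (2 * w) = x * k / 2" for x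
        by (simp_all add: k_def power_divide)
      show ?thesis unfolding u_def \<kappa>_def k by (simp add: algebra_simps power2_eq_square)
    qed
    ultimately show ?thesis by simp
  qed
  define h where "h s = (norm (u (c + of_real s)))\<^sup>2 + (norm (v (c + of_real s)))\<^sup>2" for s
  define m where "m = M / \<delta>\<^sup>2"
  \<comment> \<open>In the derivative of the energy the part \<open>- u\<close> of \<open>v'\<close>
    cancels against \<open>u' = v\<close> in the real inner product; only the \<kappa> term is
    left.\<close>
  define h' where "h' s = 2 * (v (c + of_real s) \<bullet> (\<kappa> (c + of_real s) * u (c + of_real s)))" for s
  have M0: "M \<ge> 0" using M norm_ge_zero order_trans by blast
  have dh: "(h has_real_derivative h' s) (at s)" if s: "s \<ge> 0" for s
  proof -
    have lin: "((\<lambda>s. c + of_real s) has_vector_derivative 1) (at s)"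
      by (auto intro!: derivative_eq_intros)
    have U: "((\<lambda>s. u (c + of_real s)) has_vector_derivative v (c + of_real s)) (at s)"
      using field_vector_diff_chain_at[OF lin du[OF ray[OF s]]] by (simp add: o_def)
    have V: "((\<lambda>s. v (c + of_real s)) has_vector_derivative - u (c + of_real s) + \<kappa> (c + of_real s) * u (c + of_real s)) (at s)"
      using field_vector_diff_chain_at[OF lin dv[OF ray[OF s]]] by (simp add: o_def)
    have "((\<lambda>s. u (c + of_real s) \<bullet> u (c + of_real s) + v (c + of_real s) \<bullet> v (c + of_real s)) has_vector_derivative
        (u (c + of_real s) \<bullet> v (c + of_real s) + v (c + of_real s) \<bullet> u (c + of_real s)) +
        (v (c + of_real s) \<bullet> (- u (c + of_real s) + \<kappa> (c + of_real s) * u (c + of_real s))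
        + (- u (c + of_real s) + \<kappa> (c + of_real s) * u (c + of_real s)) \<bullet> v (c + of_real s))) (at s)"
      by (intro has_vector_derivative_add bounded_bilinear.has_vector_derivative[OF bounded_bilinear_inner] U V)
    then show ?thesis
      by (simp add: h_def[abs_def] h'_def power2_norm_eq_inner inner_add_right inner_add_left inner_diff_right inner_diff_left inner_commute algebra_simps
          has_real_derivative_iff_has_vector_derivative)
  qed
  have h'_le: "h' s \<le> m / (1 + s)\<^sup>2 * h s" if s: "s \<ge> 0" for s
  proof -
    define U V K where "U = u (c + of_real s)" "V = v (c + of_real s)" "K = \<kappa> (c + of_real s)"
    have K: "norm K \<le> m / (1 + s)\<^sup>2"
    proof -
      have "(\<delta> * (1 + s))\<^sup>2 \<le> (norm (c + of_real s))\<^sup>2"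
        using \<delta> s by (intro power_mono) auto
      moreover have "0 < (\<delta> * (1 + s))\<^sup>2" using \<delta>(1) s by simp
      ultimately have "norm (\<nu>\<^sup>2 - 1 / 4) / (norm (c + of_real s))\<^sup>2 \<le> M / (\<delta> * (1 + s))\<^sup>2"
        using M M0 by (intro frac_le) auto
      then show ?thesis by (simp add: U_V_K_def \<kappa>_def norm_divide norm_power m_def power_mult_distrib)
    qed
    have "2 * (V \<bullet> (K * U)) \<le> 2 * (norm V * (norm K * norm U))"
      using norm_cauchy_schwarz[of V "K * U"] by (simp add: norm_mult)
    also have "\<dots> = norm K * (2 * norm U * norm V)" by simp
    also have "\<dots> \<le> norm K * ((norm U)\<^sup>2 + (norm V)\<^sup>2)"
      by (intro mult_left_mono sum_squares_bound) simp
    also have "\<dots> \<le> m / (1 + s)\<^sup>2 * ((norm U)\<^sup>2 + (norm V)\<^sup>2)"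
      by (intro mult_right_mono K) simp
    finally show ?thesis by (simp add: h'_def h_def U_V_K_def)
  qed
  \<comment> \<open>The exponential is the integrating factor for the rate
    \<open>m / (1 + s)^2\<close>. It is at least 1 at \<open>s\<close> and equals
    \<open>exp m\<close> at 0, which gives the factor in the claim.\<close>
  define g where "g s = h s * exp (m / (1 + s))" for s
  have "g s \<le> g 0"
  proof (rule DERIV_nonpos_imp_nonincreasing[OF s])
    fix t assume t: "0 \<le> t" "t \<le> s"
    have "(g has_real_derivative h t * (exp (m / (1 + t)) * (- m / (1 + t)\<^sup>2)) + h' t * exp (m / (1 + t))) (at t)"
      unfolding g_def[abs_def] using t(1)
      by (intro DERIV_mult' dh) (auto intro!: derivative_eq_intros simp: power2_eq_square)
    moreover have "h t * (exp (m / (1 + t)) * (- m / (1 + t)\<^sup>2)) + h' t * exp (m / (1 + t))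
        = (h' t - m / (1 + t)\<^sup>2 * h t) * exp (m / (1 + t))"
      by (simp add: algebra_simps)
    ultimately show "\<exists>y. DERIV g t :> y \<and> y \<le> 0"
      using h'_le[OF t(1)] by (intro exI[of _ "(h' t - m / (1 + t)\<^sup>2 * h t) * exp (m / (1 + t))"]) (auto intro: mult_nonpos_nonneg)
  qed
  moreover have "h s * 1 \<le> h s * exp (m / (1 + s))"
    using M0 s by (intro mult_left_mono) (auto simp: h_def m_def)
  ultimately have "h s \<le> h 0 * exp m" by (simp add: g_def)
  moreover have "norm (c + of_real s) * (norm (bessel_J \<nu> (c + of_real s)))\<^sup>2 \<le> h s"
    by (simp add: h_def u_def norm_mult power_mult_distrib)
  moreover have "h 0 = norm c * ((norm (bessel_J \<nu> c))\<^sup>2 + (norm ((\<nu> + 1 / 2) / c * bessel_J \<nu> c - bessel_J (\<nu> + 1) c))\<^sup>2)"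
    unfolding h_def u_def v_def by (simp only: norm_mult norm_csqrt power_mult_distrib of_real_0 add_0_right
        real_sqrt_pow2[OF norm_ge_zero] distrib_left)
  ultimately show ?thesis unfolding m_def by simp
qed

text \<open>The substitution \<open>t = s / (1 + s)\<close> compactifies the half-line:
  \<open>(c + s) / (1 + s)\<close> is the point \<open>(1 - t) c + t\<close> on the segment from c
  to 1. The slit plane is star-shaped about 1, so this never vanishes, and its norm attains a
  positive minimum over \<open>D\<close> and [0, 1].\<close>

lemma ray_distance_lower_bound:
  fixes D :: "complex set"
  assumes "compact D" "D \<subseteq> - \<real>\<^sub>\<le>\<^sub>0"
  shows "\<exists>\<delta>>0. \<forall>c\<in>D. \<forall>s\<ge>0. \<delta> * (1 + s) \<le> norm (c + of_real s)"
proof (cases "D = {}")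
  case True
  then show ?thesis by (intro exI[of _ 1]) auto
next
  case False
  define p where "p x = (case x of (c, t) \<Rightarrow> (1 - of_real t) * c + of_real t)" for x :: "complex \<times> real"
  have "compact (D \<times> {0..1::real})" using assms by (intro compact_Times) auto
  moreover have "continuous_on (D \<times> {0..1}) (\<lambda>x. norm (p x))"
    unfolding p_def case_prod_unfold by (intro continuous_intros)
  ultimately obtain x where x: "x \<in> D \<times> {0..1}" "\<And>y. y \<in> D \<times> {0..1} \<Longrightarrow> norm (p x) \<le> norm (p y)"
    using continuous_attains_inf[of "D \<times> {0..1::real}" "\<lambda>x. norm (p x)"] False by auto
  have "p x \<noteq> 0"
  proof
    assume "p x = 0"
    obtain c t where ct: "x = (c, t)" by (cases x)
    have c: "c \<in> - \<real>\<^sub>\<le>\<^sub>0" and t: "0 \<le> t" "t \<le> 1" using x assms ct by auto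
    have re: "(1 - t) * Re c + t = 0" and im: "(1 - t) * Im c = 0"
      using \<open>p x = 0\<close> by (simp_all add: p_def ct complex_eq_iff)
    have "t \<noteq> 1" using re by auto
    then have "Im c = 0" using im by simp
    then have "Re c > 0" using c unfolding complex_slit_iff by simp
    then have "(1 - t) * Re c > 0" using t \<open>t \<noteq> 1\<close> by simp
    then show False using re t by simp
  qed
  then have "norm (p x) > 0" by simp
  moreover have "norm (p x) * (1 + s) \<le> norm (c + of_real s)" if "c \<in> D" "s \<ge> 0" for c s
  proof -
    have "norm (p x) \<le> norm (p (c, s / (1 + s)))" using that by (intro x(2)) auto
    also have "p (c, s / (1 + s)) = (c + of_real s) / of_real (1 + s)"
    proof -
      have "(1 + of_real s :: complex) \<noteq> 0" using that(2) by (simp add: complex_eq_iff)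
      then have "1 - of_real s / (1 + of_real s) = 1 / (1 + of_real s :: complex)" by (simp add: field_simps)
      then show ?thesis by (simp add: p_def add_divide_distrib)
    qed
    finally show ?thesis using that by (simp add: norm_divide field_simps del: of_real_add)
  qed
  ultimately show ?thesis by blast
qed

text \<open>One constant for all orders and starting points in compact sets, as the majorants for
  continuation in either variable require.\<close>

lemma norm_bessel_J_ray_le:
  assumes "compact N" "compact D" "D \<subseteq> - \<real>\<^sub>\<le>\<^sub>0"
  shows "\<exists>C. \<forall>\<nu>\<in>N. \<forall>c\<in>D. \<forall>s\<ge>0. norm (bessel_J \<nu> (c + of_real s)) \<le> C / sqrt (1 + s)"
proof -
  obtain \<delta> where \<delta>: "\<delta> > 0" "\<And>c s. c \<in> D \<Longrightarrow> s \<ge> 0 \<Longrightarrow> \<delta> * (1 + s) \<le> norm (c + of_real s)"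
    using ray_distance_lower_bound[OF assms(2,3)] by blast
  have "bounded ((\<lambda>\<nu>. \<nu>\<^sup>2 - 1 / 4) ` N)"
    using assms(1) by (intro compact_imp_bounded compact_continuous_image continuous_intros)
  then obtain M where M: "\<And>\<nu>. \<nu> \<in> N \<Longrightarrow> norm (\<nu>\<^sup>2 - 1 / 4) \<le> M"
    unfolding bounded_iff by blast
  define H where "H x = (case x of (\<nu>, c) \<Rightarrow> norm c * ((norm (bessel_J \<nu> c))\<^sup>2 +
      (norm ((\<nu> + 1 / 2) / c * bessel_J \<nu> c - bessel_J (\<nu> + 1) c))\<^sup>2))" for x
  have "continuous_on (N \<times> D) H"
    unfolding H_def case_prod_unfold by (intro continuous_intros) (use assms(3) in auto)
  then have "bounded (H ` (N \<times> D))"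
    using assms by (intro compact_imp_bounded compact_continuous_image compact_Times)
  then obtain B where B: "\<And>x. x \<in> N \<times> D \<Longrightarrow> norm (H x) \<le> B"
    unfolding bounded_iff by blast
  define C where "C = sqrt (B * exp (M / \<delta>\<^sup>2) / \<delta>)"
  have "norm (bessel_J \<nu> (c + of_real s)) \<le> C / sqrt (1 + s)" if \<nu>: "\<nu> \<in> N" and c: "c \<in> D" and s: "s \<ge> 0" for \<nu> c s
  proof -
    have ray: "c + of_real t \<in> - \<real>\<^sub>\<le>\<^sub>0" if "t \<ge> 0" for t
      using c assms(3) that by (force simp: complex_nonpos_Reals_iff)
    have "norm (c + of_real s) * (norm (bessel_J \<nu> (c + of_real s)))\<^sup>2 \<le> H (\<nu>, c) * exp (M / \<delta>\<^sup>2)"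
      using bessel_J_ray_energy[OF ray \<delta>(1) \<delta>(2)[OF c] M[OF \<nu>] s] by (simp add: H_def)
    also have "\<dots> \<le> B * exp (M / \<delta>\<^sup>2)"
      using B[of "(\<nu>, c)"] \<nu> c by (intro mult_right_mono) auto
    finally have 1: "norm (c + of_real s) * (norm (bessel_J \<nu> (c + of_real s)))\<^sup>2 \<le> B * exp (M / \<delta>\<^sup>2)" .
    have 2: "\<delta> * (1 + s) * (norm (bessel_J \<nu> (c + of_real s)))\<^sup>2 \<le> norm (c + of_real s) * (norm (bessel_J \<nu> (c + of_real s)))\<^sup>2"
      by (intro mult_right_mono \<delta>(2) c s) simp
    have "(norm (bessel_J \<nu> (c + of_real s)))\<^sup>2 \<le> B * exp (M / \<delta>\<^sup>2) / \<delta> / (1 + s)"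
    proof -
      have "X \<le> Y / \<delta> / (1 + s)" if "\<delta> * (1 + s) * X \<le> Y" for X Y
        using that \<delta>(1) s by (simp add: pos_le_divide_eq mult_ac)
      from this[OF order_trans[OF 2 1]] show ?thesis .
    qed
    then have "norm (bessel_J \<nu> (c + of_real s)) \<le> sqrt (B * exp (M / \<delta>\<^sup>2) / \<delta> / (1 + s))"
      by (rule real_le_rsqrt)
    then show ?thesis by (simp add: C_def real_sqrt_divide real_sqrt_mult)
  qed
  then show ?thesis by blast
qed

text \<open>With \<open>b z = c + s\<close> and \<open>c = 2 a z\<close>, the integrand becomes
  \<open>J (c + s)\<close> over a root of \<open>(c + s)^2 - c^2 = s (2 c + s)\<close>. Splitting
  off \<open>sqrt s\<close> leaves the root of a point of the slit plane, which is analytic in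
  \<open>c\<close>.\<close>

definition ray_kernel :: "complex \<Rightarrow> complex \<Rightarrow> real \<Rightarrow> complex" where
  "ray_kernel \<nu> c s = bessel_J \<nu> (c + of_real s) / (of_real (sqrt s) * csqrt (2 * c + of_real s))"

lemma norm_ray_kernel_le:
  assumes "compact N" "compact D" "D \<subseteq> - \<real>\<^sub>\<le>\<^sub>0"
  shows "\<exists>C. \<forall>\<nu>\<in>N. \<forall>c\<in>D. \<forall>s>0. norm (ray_kernel \<nu> c s) \<le> C * (1 / (sqrt s * (1 + s)))"
proof -
  obtain \<delta> where \<delta>: "\<delta> > 0" "\<And>c s. c \<in> D \<Longrightarrow> s \<ge> 0 \<Longrightarrow> \<delta> * (1 + s) \<le> norm (c + of_real s)"
    using ray_distance_lower_bound[OF assms(2,3)] by blast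
  obtain C where C: "\<And>\<nu> c s. \<nu> \<in> N \<Longrightarrow> c \<in> D \<Longrightarrow> s \<ge> 0 \<Longrightarrow> norm (bessel_J \<nu> (c + of_real s)) \<le> C / sqrt (1 + s)"
    using norm_bessel_J_ray_le[OF assms] by blast
  have "norm (ray_kernel \<nu> c s) \<le> C / sqrt \<delta> * (1 / (sqrt s * (1 + s)))" if \<nu>: "\<nu> \<in> N" and c: "c \<in> D" and s: "s > 0" for \<nu> c s
  proof -
    have Cn: "0 \<le> C / sqrt (1 + s)" using C[OF \<nu> c, of s] s norm_ge_zero order_trans less_imp_le by meson
    \<comment> \<open>Since \<open>2 c + s = 2 (c + s / 2)\<close>, the distance bound is applied at
      \<open>s / 2\<close>. This root contributes the second factor \<open>1 / sqrt (1 + s)\<close>,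
      beside the one from \<open>J\<close>.\<close>
    have "\<delta> * (1 + s) \<le> 2 * (\<delta> * (1 + s / 2))" using \<delta>(1) s by (simp add: algebra_simps)
    also have "\<dots> \<le> 2 * norm (c + of_real (s / 2))" using \<delta>(2)[OF c, of "s / 2"] s by simp
    also have "\<dots> = norm (2 * c + of_real s)"
      using norm_mult[of 2 "c + of_real (s / 2)"] by (simp add: algebra_simps)
    finally have d: "\<delta> * (1 + s) \<le> norm (2 * c + of_real s)" .
    have "norm (ray_kernel \<nu> c s) = norm (bessel_J \<nu> (c + of_real s)) / (sqrt s * sqrt (norm (2 * c + of_real s)))"
      using s by (simp add: ray_kernel_def norm_divide norm_mult)
    also have "\<dots> \<le> (C / sqrt (1 + s)) / (sqrt s * sqrt (\<delta> * (1 + s)))"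
      using C[OF \<nu> c, of s] Cn d s \<delta>(1) by (intro frac_le mult_left_mono real_sqrt_le_mono) auto
    also have "\<dots> = C / sqrt \<delta> * (1 / (sqrt s * (1 + s)))"
    proof -
      have "sqrt (1 + s) * sqrt (1 + s) = 1 + s" using s by simp
      then show ?thesis by (simp add: real_sqrt_mult)
    qed
    finally show ?thesis .
  qed
  then show ?thesis by blast
qed

text \<open>Substituting \<open>s = exp t\<close> gives \<open>1 / (2 cosh (t / 2))\<close> on the
  whole line, at most \<open>exp (- |t| / 2)\<close>.\<close>

lemma integrable_ray_majorant: "integrable (lebesgue_on {0<..}) (\<lambda>s::real. 1 / (sqrt s * (1 + s)))"
proof -
  have "integrable lborel (\<lambda>t::real. exp (- \<bar>0 + 1 / 2 * t\<bar>))"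
    by (rule lborel_integrable_real_affine[OF integrable_exp_minus_abs]) simp
  then have e: "(\<lambda>t::real. exp (- \<bar>0 + 1 / 2 * t\<bar>)) integrable_on UNIV"
    by (rule integrable_on_lborel)
  have eq: "\<bar>exp t\<bar> *\<^sub>R (1 / (sqrt (exp t) * (1 + exp t))) = 1 / (2 * cosh (t / 2))" for t :: real
  proof -
    define y where "y = exp (t / 2)"
    have y: "y > 0" "exp t = y * y" by (simp_all add: y_def flip: exp_add)
    have y3: "exp (- (t / 2)) = 1 / y" by (simp add: y_def exp_minus inverse_eq_divide)
    have "2 * cosh (t / 2) = y + 1 / y" by (simp add: cosh_field_def y3 flip: y_def)
    moreover have "y + y * (y * y) > 0" using y(1) by (intro add_pos_pos mult_pos_pos)
    ultimately show ?thesis using y(1) unfolding y(2) by (simp add: field_simps real_sqrt_mult_self)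
  qed
  have "(\<lambda>t::real. 1 / (2 * cosh (t / 2))) absolutely_integrable_on UNIV"
  proof (rule measurable_bounded_by_integrable_imp_absolutely_integrable[OF _ _ e])
    show "(\<lambda>t::real. 1 / (2 * cosh (t / 2))) \<in> borel_measurable (lebesgue_on UNIV)"
      by (intro continuous_imp_measurable_on_sets_lebesgue continuous_intros) auto
    show "norm (1 / (2 * cosh (t / 2))) \<le> exp (- \<bar>0 + 1 / 2 * t\<bar>)" for t :: real
      using cosh_ge_exp_half[of "t / 2"] by (simp add: exp_minus field_simps)
  qed auto
  then have "(\<lambda>t::real. \<bar>exp t\<bar> *\<^sub>R (1 / (sqrt (exp t) * (1 + exp t)))) absolutely_integrable_on UNIV"
    unfolding eq .
  then have "(\<lambda>s::real. 1 / (sqrt s * (1 + s))) absolutely_integrable_on range exp"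
    by (subst absolutely_integrable_change_of_variables_real[where h = exp])
       (auto simp: inj_on_def intro!: derivative_eq_intros)
  then show ?thesis
    unfolding range_exp_real by (simp add: set_integrable_def integrable_restrict_space)
qed

definition ray_integral :: "complex \<Rightarrow> complex \<Rightarrow> complex" where
  "ray_integral \<nu> c = (\<integral>s. ray_kernel \<nu> c s \<partial>lebesgue_on {0<..})"

lemma ray_in_slit: "(c :: complex) \<in> - \<real>\<^sub>\<le>\<^sub>0 \<Longrightarrow> s > 0 \<Longrightarrow> c + of_real s \<in> - \<real>\<^sub>\<le>\<^sub>0"
  "(c :: complex) \<in> - \<real>\<^sub>\<le>\<^sub>0 \<Longrightarrow> s > 0 \<Longrightarrow> 2 * c + of_real s \<in> - \<real>\<^sub>\<le>\<^sub>0"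
  by (auto simp: complex_nonpos_Reals_iff)

lemma ray_kernel_measurable:
  assumes "c \<in> - \<real>\<^sub>\<le>\<^sub>0"
  shows "ray_kernel \<nu> c \<in> borel_measurable (lebesgue_on {0<..})"
proof (rule continuous_imp_measurable_on_sets_lebesgue)
  have nz: "2 * c + of_real s \<noteq> 0" if "s > 0" for s using ray_in_slit(2)[OF assms that] by auto
  have "continuous_on {0<..} (\<lambda>s::real. csqrt (2 * c + of_real s))"
    by (rule continuous_on_compose2[OF continuous_on_csqrt])
       (use ray_in_slit[OF assms] in \<open>auto intro!: continuous_intros\<close>)
  then show "continuous_on {0<..} (ray_kernel \<nu> c)"
    unfolding ray_kernel_def[abs_def] using ray_in_slit[OF assms] nz
    by (intro continuous_intros) auto
qed auto

lemma integrable_ray_kernel: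
  assumes c: "c \<in> - \<real>\<^sub>\<le>\<^sub>0"
  shows "integrable (lebesgue_on {0<..}) (ray_kernel \<nu> c)"
proof -
  obtain C where C: "\<And>s. s > 0 \<Longrightarrow> norm (ray_kernel \<nu> c s) \<le> C * (1 / (sqrt s * (1 + s)))"
    using norm_ray_kernel_le[of "{\<nu>}" "{c}"] c by auto
  show ?thesis
  proof (rule Bochner_Integration.integrable_bound[OF _ ray_kernel_measurable[OF c]])
    show "integrable (lebesgue_on {0<..}) (\<lambda>s. C * (1 / (sqrt s * (1 + s))))"
      using integrable_ray_majorant by (rule integrable_mult_right)
    show "AE s in lebesgue_on {0<..}. norm (ray_kernel \<nu> c s) \<le> norm (C * (1 / (sqrt s * (1 + s))))"
    proof (intro AE_I2)
      fix s assume "s \<in> space (lebesgue_on {0::real<..})"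
      then have "s > 0" by simp
      from C[OF this] show "norm (ray_kernel \<nu> c s) \<le> norm (C * (1 / (sqrt s * (1 + s))))"
        by (rule order_trans) (simp only: real_norm_def abs_ge_self)
    qed
  qed
qed

lemma ray_integral_holomorphic: "ray_integral \<nu> holomorphic_on - \<real>\<^sub>\<le>\<^sub>0"
  unfolding ray_integral_def[abs_def]
proof (rule holomorphic_on_parameter_integral)
  show op: "open (- \<real>\<^sub>\<le>\<^sub>0 :: complex set)" by (simp add: open_Compl)
  fix s assume "s \<in> space (lebesgue_on {0::real<..})"
  then have s: "s > 0" by simp
  have nz: "2 * c + of_real s \<noteq> 0" if "c \<in> - \<real>\<^sub>\<le>\<^sub>0" for c :: complex using ray_in_slit(2)[OF that s] by auto
  have "(\<lambda>c. csqrt (2 * c + of_real s)) holomorphic_on - \<real>\<^sub>\<le>\<^sub>0"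
    using holomorphic_on_compose_gen[OF _ holomorphic_on_csqrt, of "\<lambda>c. 2 * c + of_real s" "- \<real>\<^sub>\<le>\<^sub>0"] ray_in_slit(2) s
    by (force simp: o_def intro!: holomorphic_intros)
  then show "(\<lambda>c. ray_kernel \<nu> c s) holomorphic_on - \<real>\<^sub>\<le>\<^sub>0"
    unfolding ray_kernel_def using ray_in_slit s nz
    by (intro holomorphic_intros) auto
next
  fix c :: complex assume "c \<in> - \<real>\<^sub>\<le>\<^sub>0"
  moreover have "open (- \<real>\<^sub>\<le>\<^sub>0 :: complex set)" by (simp add: open_Compl)
  ultimately obtain r where r: "r > 0" "cball c r \<subseteq> - \<real>\<^sub>\<le>\<^sub>0" by (meson open_contains_cball)
  obtain C where C: "\<And>w s. w \<in> cball c r \<Longrightarrow> s > 0 \<Longrightarrow> norm (ray_kernel \<nu> w s) \<le> C * (1 / (sqrt s * (1 + s)))"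
  proof -
    have "compact {\<nu>}" by simp
    from norm_ray_kernel_le[OF this compact_cball r(2)] that show ?thesis by blast
  qed
  show "\<exists>r>0. \<exists>h. integrable (lebesgue_on {0<..}) h \<and> ball c r \<subseteq> - \<real>\<^sub>\<le>\<^sub>0 \<and>
      (\<forall>w\<in>ball c r. \<forall>s\<in>space (lebesgue_on {0<..}). norm (ray_kernel \<nu> w s) \<le> h s)"
  proof (intro exI conjI ballI)
    show "r > 0" by (rule r(1))
    show "integrable (lebesgue_on {0<..}) (\<lambda>s. C * (1 / (sqrt s * (1 + s))))"
      by (rule integrable_mult_right[OF integrable_ray_majorant])
    show "ball c r \<subseteq> - \<real>\<^sub>\<le>\<^sub>0" using r(2) ball_subset_cball by blast
    show "norm (ray_kernel \<nu> w s) \<le> C * (1 / (sqrt s * (1 + s)))"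
      if "w \<in> ball c r" "s \<in> space (lebesgue_on {0<..})" for w s
      using that ball_subset_cball by (intro C) auto
  qed
qed (rule ray_kernel_measurable)

lemma ray_integral_holomorphic_order:
  assumes c: "c \<in> - \<real>\<^sub>\<le>\<^sub>0"
  shows "(\<lambda>\<nu>. ray_integral \<nu> c) holomorphic_on UNIV"
  unfolding ray_integral_def[abs_def]
proof (rule holomorphic_on_parameter_integral)
  show "(\<lambda>\<nu>. ray_kernel \<nu> c s) holomorphic_on UNIV" if "s \<in> space (lebesgue_on {0<..})" for s
    unfolding ray_kernel_def divide_inverse by (intro holomorphic_intros)
  fix \<nu> :: complex
  obtain C where C: "\<And>w s. w \<in> cball \<nu> 1 \<Longrightarrow> s > 0 \<Longrightarrow> norm (ray_kernel w c s) \<le> C * (1 / (sqrt s * (1 + s)))"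
  proof -
    have "compact {c}" "{c} \<subseteq> - \<real>\<^sub>\<le>\<^sub>0" using c by auto
    from norm_ray_kernel_le[OF compact_cball[of \<nu> 1] this] that show ?thesis by blast
  qed
  show "\<exists>r>0. \<exists>h. integrable (lebesgue_on {0<..}) h \<and> ball \<nu> r \<subseteq> UNIV \<and>
      (\<forall>w\<in>ball \<nu> r. \<forall>s\<in>space (lebesgue_on {0<..}). norm (ray_kernel w c s) \<le> h s)"
  proof (intro exI conjI ballI)
    show "(1::real) > 0" by simp
    show "integrable (lebesgue_on {0<..}) (\<lambda>s. C * (1 / (sqrt s * (1 + s))))"
      by (rule integrable_mult_right[OF integrable_ray_majorant])
    show "norm (ray_kernel w c s) \<le> C * (1 / (sqrt s * (1 + s)))"
      if "w \<in> ball \<nu> 1" "s \<in> space (lebesgue_on {0<..})" for w s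
      using that ball_subset_cball by (intro C) auto
  qed simp
qed (use ray_kernel_measurable[OF c] in auto)

section \<open>Analytic continuation\<close>

lemma absolutely_integrable_even_half:
  fixes f :: "real \<Rightarrow> complex"
  assumes f: "integrable lborel f" and even: "\<And>x. f (- x) = f x"
  shows "f absolutely_integrable_on {0<..}" "integral {0<..} f = (\<integral>x. f x \<partial>lborel) / 2"
proof -
  have U: "f absolutely_integrable_on UNIV"
    using f by (simp add: set_integrable_def integrable_completion)
  show P: "f absolutely_integrable_on {0<..}"
    by (rule set_integrable_subset[OF U]) auto
  have N: "f absolutely_integrable_on {..<0}"
    by (rule set_integrable_subset[OF U]) auto
  have im: "uminus ` {0<..} = {..<0::real}" by (auto simp: image_iff)
  have "f absolutely_integrable_on uminus ` {0<..} \<and> integral (uminus ` {0<..}) f = integral {0<..} f"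
    by (subst has_absolute_integral_change_of_variables_real[symmetric, where h = "\<lambda>_. - 1"])
       (use P in \<open>auto simp: even intro!: derivative_eq_intros\<close>)
  then have neg: "integral {..<0} f = integral {0<..} f" by (simp add: im)
  have "integral UNIV f = integral ({..<0} \<union> {0<..}) f"
    by (rule integral_spike_set) (auto intro: negligible_subset[of "{0}"])
  also have "\<dots> = integral {..<0} f + integral {0<..} f"
  proof (rule Henstock_Kurzweil_Integration.integral_Un)
    have "{..<0} \<inter> {0<..} = ({} :: real set)" by auto
    then show "negligible ({..<0} \<inter> {0<..} :: real set)" by simp
  qed (use P N in \<open>auto simp: set_lebesgue_integral_eq_integral(1)\<close>)
  also have "integral UNIV f = (\<integral>x. f x \<partial>lborel)" by (rule integral_lborel[OF f])
  finally show "integral {0<..} f = (\<integral>x. f x \<partial>lborel) / 2" by (simp add: neg)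
qed

lemma ray_integral_henstock_kurzweil:
  assumes "c \<in> - \<real>\<^sub>\<le>\<^sub>0"
  shows "ray_kernel \<nu> c absolutely_integrable_on {0<..}" "integral {0<..} (ray_kernel \<nu> c) = ray_integral \<nu> c"
proof -
  show "ray_kernel \<nu> c absolutely_integrable_on {0<..}"
    using integrable_ray_kernel[OF assms, of \<nu>] by (simp add: set_integrable_def integrable_restrict_space)
  show "integral {0<..} (ray_kernel \<nu> c) = ray_integral \<nu> c"
    unfolding ray_integral_def
    by (rule integral_unique, rule has_integral_integral_lebesgue_on[OF integrable_ray_kernel[OF assms]]) simp
qed

text \<open>The substitution \<open>s = c (cosh q - 1)\<close> makes \<open>c + s = c cosh q\<close>
  and \<open>s (2 c + s) = (c sinh q)^2\<close>, so the Jacobian cancels the root; evenness in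
  \<open>q\<close> accounts for the factor 1/2.\<close>

lemma ray_integral_real:
  fixes \<nu> c :: real
  assumes \<nu>: "0 < \<nu>" "\<nu> < 1" and c: "c > 0"
  shows "ray_integral \<nu> c = of_real pi / 2 * bessel_J (of_real \<nu> / 2) (of_real c / 2) *
        (bessel_J (- (of_real \<nu> / 2)) (of_real c / 2) - bessel_J (of_real \<nu> / 2) (of_real c / 2) * cos (of_real pi * (of_real \<nu> / 2)))
        / sin (of_real pi * (of_real \<nu> / 2))"
proof -
  define f where "f q = bessel_J \<nu> (of_real (c * cosh q))" for q :: real
  define g where "g q = c * (cosh q - 1)" for q
  have im: "g ` {0<..} = {0<..}"
  proof (intro equalityI subsetI)
    fix s assume "s \<in> g ` {0<..}"
    then obtain q where "q > 0" "s = g q" by auto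
    moreover have "cosh q > cosh 0" if "q > 0" using that by (subst cosh_real_nonneg_less_iff) auto
    ultimately show "s \<in> {0<..}" using c by (simp add: g_def)
  next
    fix s :: real assume s: "s \<in> {0<..}"
    define q where "q = arcosh (1 + s / c)"
    have ch: "cosh q = 1 + s / c" unfolding q_def using s c by (intro cosh_arcosh_real) auto
    have "q \<noteq> 0"
    proof
      assume "q = 0"
      then show False using ch s c by simp
    qed
    then have "\<bar>q\<bar> \<in> {0<..}" by simp
    moreover have "s = g \<bar>q\<bar>" using ch c by (simp add: g_def)
    ultimately show "s \<in> g ` {0<..}" by blast
  qed
  have dg: "(g has_real_derivative c * sinh q) (at q within S)" for q S
    unfolding g_def[abs_def] by (auto intro!: derivative_eq_intros)
  have inj: "inj_on g {0<..}" using c by (auto simp: inj_on_def g_def)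
  have key: "\<bar>c * sinh q\<bar> *\<^sub>R ray_kernel \<nu> c (g q) = f q" if q: "q \<in> {0<..}" for q
  proof -
    have q0: "q > 0" using q by simp
    have ch: "cosh q - 1 \<ge> 0" using cosh_real_ge_1[of q] by simp
    have w: "2 * complex_of_real c + of_real (g q) = of_real (c * (cosh q + 1))"
      by (simp add: g_def algebra_simps)
    have "complex_of_real (sqrt (g q)) * csqrt (2 * of_real c + of_real (g q)) = of_real (sqrt (g q) * sqrt (c * (cosh q + 1)))"
      unfolding w using c ch by (subst csqrt_of_real) auto
    also have "sqrt (g q) * sqrt (c * (cosh q + 1)) = sqrt ((c * sinh q)\<^sup>2)"
      unfolding real_sqrt_mult[symmetric] g_def
      using cosh_square_eq[of q] by (simp add: power_mult_distrib algebra_simps power2_eq_square)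
    also have "\<dots> = c * sinh q" using c q0 by simp
    finally have d: "complex_of_real (sqrt (g q)) * csqrt (2 * of_real c + of_real (g q)) = of_real (c * sinh q)" .
    have n: "complex_of_real c + of_real (g q) = of_real (c * cosh q)" by (simp add: g_def algebra_simps)
    define y where "y = c * sinh q"
    have "y > 0" using c q0 by (simp add: y_def)
    then show ?thesis unfolding ray_kernel_def d n f_def y_def[symmetric] by (simp add: scaleR_conv_of_real)
  qed
  have f: "integrable lborel f" unfolding f_def using bessel_J_cosh_integral(1)[OF \<nu> c] .
  have half: "f absolutely_integrable_on {0<..}" "integral {0<..} f = (\<integral>q. f q \<partial>lborel) / 2"
    by (rule absolutely_integrable_even_half[OF f], simp add: f_def)+
  have "(\<lambda>q. \<bar>c * sinh q\<bar> *\<^sub>R ray_kernel \<nu> c (g q)) absolutely_integrable_on {0<..}"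
    using half(1) by (rule absolutely_integrable_spike[OF _ negligible_empty]) (use key in auto)
  moreover have "integral {0<..} (\<lambda>q. \<bar>c * sinh q\<bar> *\<^sub>R ray_kernel \<nu> c (g q)) = integral {0<..} f"
    by (rule Henstock_Kurzweil_Integration.integral_cong) (use key in auto)
  ultimately have "ray_kernel \<nu> c absolutely_integrable_on g ` {0<..} \<and> integral (g ` {0<..}) (ray_kernel \<nu> c) = integral {0<..} f"
    by (subst has_absolute_integral_change_of_variables_real[symmetric, where h = "\<lambda>q. c * sinh q"])
       (use inj in \<open>auto simp: dg\<close>)
  then have "ray_integral \<nu> c = (\<integral>q. f q \<partial>lborel) / 2"
    using ray_integral_henstock_kurzweil(2)[of "of_real c" \<nu>] c by (simp add: im half(2) complex_nonpos_Reals_iff)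
  also have "(\<integral>q. f q \<partial>lborel) = of_real pi * bessel_J (of_real \<nu> / 2) (of_real c / 2) *
        (bessel_J (- (of_real \<nu> / 2)) (of_real c / 2) - bessel_J (of_real \<nu> / 2) (of_real c / 2) * cos (of_real pi * (of_real \<nu> / 2)))
        / sin (of_real pi * (of_real \<nu> / 2))"
    unfolding f_def by (rule bessel_J_cosh_integral(2)[OF \<nu> c])
  finally show ?thesis by simp
qed

lemma islimpt_of_real_interval:
  assumes "a < x" "x < b"
  shows "complex_of_real x islimpt (of_real ` {a<..<b})"
proof -
  have "x islimpt {a<..<b}" using assms by (intro open_imp_islimpt) auto
  then have "of_real x islimpt (complex_of_real ` {a<..<b})"
    by (rule islimpt_isCont_image) (auto simp: eventually_at_filter)
  then show ?thesis .
qed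

lemma ray_integral_eq:
  assumes c: "c \<in> - \<real>\<^sub>\<le>\<^sub>0"
  shows "ray_integral \<nu> c * sin (of_real pi * (\<nu> / 2)) = of_real pi / 2 * bessel_J (\<nu> / 2) (c / 2) *
        (bessel_J (- (\<nu> / 2)) (c / 2) - bessel_J (\<nu> / 2) (c / 2) * cos (of_real pi * (\<nu> / 2)))"
proof -
  define P where "P \<nu> c = ray_integral \<nu> c * sin (of_real pi * (\<nu> / 2)) - of_real pi / 2 * bessel_J (\<nu> / 2) (c / 2) *
        (bessel_J (- (\<nu> / 2)) (c / 2) - bessel_J (\<nu> / 2) (c / 2) * cos (of_real pi * (\<nu> / 2)))" for \<nu> c
  have half: "w / 2 \<in> - \<real>\<^sub>\<le>\<^sub>0" if "w \<in> - \<real>\<^sub>\<le>\<^sub>0" for w :: complex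
    using that by (auto simp: complex_nonpos_Reals_iff)
  \<comment> \<open>Two one-variable continuations in succession suffice: here in \<open>c\<close>
    at a fixed real order, afterwards in the order at a fixed \<open>c\<close>.\<close>
  have Pc: "P (of_real \<nu>) w = 0" if \<nu>: "\<nu> \<in> {0<..<1}" and w: "w \<in> - \<real>\<^sub>\<le>\<^sub>0" for \<nu> :: real and w
  proof (rule analytic_continuation[of "P (of_real \<nu>)"])
    show "P (of_real \<nu>) holomorphic_on - \<real>\<^sub>\<le>\<^sub>0"
      unfolding P_def[abs_def] using half
      by (intro holomorphic_intros ray_integral_holomorphic) auto
    show "open (- \<real>\<^sub>\<le>\<^sub>0 :: complex set)" by (simp add: open_Compl)
    show "connected (- \<real>\<^sub>\<le>\<^sub>0 :: complex set)"
    proof -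
      have "(\<real>\<^sub>\<le>\<^sub>0 :: complex set) = of_real ` {..0}" by (auto simp: nonpos_Reals_def)
      then show ?thesis using starlike_imp_connected[OF starlike_slotted_complex_plane_left[of 0]] by simp
    qed
    show "of_real ` {0<..<2} \<subseteq> (- \<real>\<^sub>\<le>\<^sub>0 :: complex set)" by (auto simp: complex_nonpos_Reals_iff)
    show "complex_of_real 1 islimpt (of_real ` {0<..<2})" by (rule islimpt_of_real_interval) auto
    show "complex_of_real 1 \<in> - \<real>\<^sub>\<le>\<^sub>0" by (simp add: complex_nonpos_Reals_iff)
    fix x :: complex assume "x \<in> of_real ` {0<..<2}"
    then obtain r where r: "x = of_real r" "r > 0" by auto
    have "sin (of_real pi * (of_real \<nu> / 2)) \<noteq> (0 :: complex)"
      using sin_pi_of_real_nonzero[of "\<nu> / 2"] \<nu> by simp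
    then show "P (of_real \<nu>) x = 0"
      unfolding P_def r(1) using ray_integral_real[of \<nu> r] \<nu> r(2) by simp
  qed (rule w)
  have "P \<nu> c = 0"
  proof (rule analytic_continuation[of "\<lambda>\<nu>. P \<nu> c" UNIV])
    show "(\<lambda>\<nu>. P \<nu> c) holomorphic_on UNIV"
      unfolding P_def by (intro holomorphic_intros ray_integral_holomorphic_order[OF c]) auto
    show "complex_of_real (1 / 2) islimpt (of_real ` {0<..<1})" by (rule islimpt_of_real_interval) auto
    show "P x c = 0" if "x \<in> of_real ` {0<..<1}" for x using that Pc[OF _ c] by auto
  qed auto
  then show ?thesis by (simp add: P_def)
qed

section \<open>Integer orders and the function Y\<close>

lemma bessel_series_minus_nat: "bessel_series (- of_nat n) y = y ^ n * bessel_series (of_nat n) y"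
proof -
  define a where "a k = y ^ k * rGamma (- of_nat n + of_nat k + 1) / fact k" for k
  have z: "a k = 0" if "k < n" for k
  proof -
    have "(- of_nat n + of_nat k + 1 :: complex) = - of_nat (n - k - 1)" using that by simp
    then have "rGamma (- of_nat n + of_nat k + 1 :: complex) = 0" by (simp only: rGamma_neg_of_nat)
    then show ?thesis by (simp add: a_def)
  qed
  have s: "a (k + n) = y ^ n * (y ^ k * rGamma (of_nat n + of_nat k + 1) / fact k)" for k
  proof -
    have 1: "rGamma (- of_nat n + of_nat (k + n) + 1) = (1 / fact k :: complex)"
      using Gamma_fact[of k, where 'a = complex] by (simp add: rGamma_inverse_Gamma inverse_eq_divide add.commute)
    have 2: "rGamma (of_nat n + of_nat k + 1) = (1 / fact (k + n) :: complex)"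
      using Gamma_fact[of "k + n", where 'a = complex] by (simp add: rGamma_inverse_Gamma inverse_eq_divide add_ac)
    show ?thesis unfolding a_def 1 2 by (simp add: power_add mult.commute)
  qed
  have "bessel_series (- of_nat n) y = (\<Sum>k. a k)" by (simp add: bessel_series_def a_def)
  also have "\<dots> = (\<Sum>k. a (k + n)) + (\<Sum>k<n. a k)"
    by (rule suminf_split_initial_segment) (use summable_bessel_series[of y "- of_nat n"] in \<open>simp add: a_def\<close>)
  also have "\<dots> = y ^ n * bessel_series (of_nat n) y"
    unfolding s suminf_mult[OF summable_bessel_series] bessel_series_def by (simp add: z)
  finally show ?thesis .
qed

lemma bessel_J_minus_nat:
  assumes "z \<noteq> 0"
  shows "bessel_J (- of_nat n) z = (- 1) ^ n * bessel_J (of_nat n) z"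
proof -
  have "(- (z\<^sup>2 / 4)) ^ n = (- 1) ^ n * ((z / 2) ^ n * (z / 2) ^ n)"
    unfolding power_minus[of "z\<^sup>2 / 4"] by (simp add: power_divide power2_eq_square power_mult_distrib flip: power_mult_distrib)
  moreover have "(z / 2) powr (- of_nat n) = inverse ((z / 2) ^ n)" "(z / 2) powr (of_nat n) = (z / 2) ^ n"
    using assms by (simp_all add: powr_minus powr_nat')
  ultimately show ?thesis
    unfolding bessel_J_eq_series bessel_series_minus_nat using assms by simp
qed

text \<open>The numerator of the quotient defining \<open>Y\<close> vanishes at integer orders, so
  the singularity there is removable.\<close>

lemma bessel_J_minus_int:
  assumes "z \<noteq> 0" "\<nu> \<in> \<int>"
  shows "bessel_J \<nu> z * cos (\<nu> * of_real pi) = bessel_J (- \<nu>) z"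
proof -
  have c: "cos (of_nat n * of_real pi) = ((- 1) ^ n :: complex)" for n
  proof -
    have "cos (of_nat n * of_real pi) = complex_of_real (cos (real n * pi))" by (simp flip: cos_of_real)
    then show ?thesis by (simp add: cos_npi)
  qed
  have sq: "(- 1) ^ n * (- 1) ^ n = (1 :: complex)" for n :: nat by (simp flip: power_mult_distrib)
  from assms(2) obtain k where k: "\<nu> = of_int k" by (auto elim: Ints_cases)
  show ?thesis
  proof (cases k)
    case (nonneg n)
    then show ?thesis using bessel_J_minus_nat[OF assms(1), of n] k c[of n] by simp
  next
    case (neg n)
    then have \<nu>: "\<nu> = - of_nat (Suc n)" using k by simp
    have "bessel_J \<nu> z * cos (\<nu> * of_real pi) = (- 1) ^ Suc n * bessel_J (of_nat (Suc n)) z * (- 1) ^ Suc n"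
      unfolding \<nu> bessel_J_minus_nat[OF assms(1)] mult_minus_left cos_minus c ..
    also have "\<dots> = bessel_J (of_nat (Suc n)) z * ((- 1) ^ Suc n * (- 1) ^ Suc n)" by (simp only: mult_ac)
    also have "\<dots> = bessel_J (- \<nu>) z" unfolding sq \<nu> by (simp only: minus_minus mult_1_right)
    finally show ?thesis .
  qed
qed

lemma sin_pi_eq_0_iff_Ints: "sin (\<nu> * complex_of_real pi) = 0 \<longleftrightarrow> \<nu> \<in> \<int>"
proof -
  have "\<nu> * of_real pi = of_real (of_int n * pi) \<longleftrightarrow> \<nu> = of_int n" for n by simp
  then show ?thesis unfolding sin_eq_0 by (auto elim: Ints_cases)
qed

lemma ray_integral_eq_bessel_JY:
  assumes x: "x \<in> - \<real>\<^sub>\<le>\<^sub>0"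
  shows "ray_integral (2 * \<mu>) (2 * x) = - (of_real pi / 2) * bessel_J \<mu> x * bessel_Y \<mu> x"
proof -
  define Q where "Q \<mu> = (bessel_J \<mu> x * cos (\<mu> * of_real pi) - bessel_J (- \<mu>) x) / sin (\<mu> * of_real pi)" for \<mu>
  have x0: "x \<noteq> 0" using x by auto
  have x2: "2 * x \<in> - \<real>\<^sub>\<le>\<^sub>0" using x by (auto simp: complex_nonpos_Reals_iff)
  have main: "ray_integral (2 * \<mu>) (2 * x) = - (of_real pi / 2) * bessel_J \<mu> x * Q \<mu>" if "\<mu> \<notin> \<int>" for \<mu>
  proof -
    have "sin (\<mu> * complex_of_real pi) \<noteq> 0" using that by (simp add: sin_pi_eq_0_iff_Ints)
    then show ?thesis using ray_integral_eq[OF x2, of "2 * \<mu>"] by (simp add: Q_def field_simps)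
  qed
  have Y: "bessel_Y \<mu> x = (if \<mu> \<in> \<int> then Lim (at \<mu>) Q else Q \<mu>)"
    by (simp add: bessel_Y_def Q_def[abs_def] Let_def)
  show ?thesis
  proof (cases "\<mu> \<in> \<int>")
    case False
    then show ?thesis using main Y by simp
  next
    case True
    define N where "N \<mu> = bessel_J \<mu> x * cos (\<mu> * of_real pi) - bessel_J (- \<mu>) x" for \<mu>
    have "N holomorphic_on UNIV" unfolding N_def[abs_def] by (intro holomorphic_intros)
    then have dN: "(N has_field_derivative deriv N \<mu>) (at \<mu>)" by (rule holomorphic_derivI) auto
    have ds: "((\<lambda>\<mu>. sin (\<mu> * of_real pi)) has_field_derivative cos (\<mu> * of_real pi) * of_real pi) (at \<mu>)"
      by (auto intro!: derivative_eq_intros)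
    have s0: "sin (\<mu> * of_real pi) = 0" using True by (simp add: sin_pi_eq_0_iff_Ints)
    have "cos (\<mu> * of_real pi) \<noteq> 0" using s0 sin_cos_squared_add[of "\<mu> * of_real pi"] by auto
    \<comment> \<open>\<open>Lim\<close> denotes something even when no limit exists, so convergence
      has to be shown first. Numerator and sine both vanish at \<mu>, the sine to first order, and
      the rule of L'Hopital gives the limit.\<close>
    then have Q: "Q \<midarrow>\<mu>\<rightarrow> deriv N \<mu> / (cos (\<mu> * of_real pi) * of_real pi)"
      unfolding Q_def[abs_def] N_def[symmetric]
      by (intro lhopital_complex_simple[OF dN ds _ s0]) (auto simp: N_def bessel_J_minus_int[OF x0 True])
    then have L: "bessel_Y \<mu> x = deriv N \<mu> / (cos (\<mu> * of_real pi) * of_real pi)"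
      using True by (simp add: Y tendsto_Lim)
    have hJ: "(\<lambda>\<mu>. bessel_J \<mu> x) holomorphic_on UNIV" by (intro holomorphic_intros)
    have J: "(\<lambda>\<mu>. bessel_J \<mu> x) \<midarrow>\<mu>\<rightarrow> bessel_J \<mu> x"
      using holomorphic_on_imp_continuous_on[OF hJ] by (simp add: continuous_on_eq_continuous_at isCont_def)
    have hF: "(\<lambda>\<mu>. ray_integral (2 * \<mu>) (2 * x)) holomorphic_on UNIV"
      using holomorphic_on_compose_gen[OF _ ray_integral_holomorphic_order[OF x2], of "\<lambda>\<mu>. 2 * \<mu>" UNIV]
      by (simp add: o_def holomorphic_intros)
    have F: "(\<lambda>\<mu>. ray_integral (2 * \<mu>) (2 * x)) \<midarrow>\<mu>\<rightarrow> ray_integral (2 * \<mu>) (2 * x)"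
      using holomorphic_on_imp_continuous_on[OF hF] by (simp add: continuous_on_eq_continuous_at isCont_def)
    have "(\<lambda>\<mu>. - (of_real pi / 2) * bessel_J \<mu> x * Q \<mu>) \<midarrow>\<mu>\<rightarrow> - (of_real pi / 2) * bessel_J \<mu> x * bessel_Y \<mu> x"
      unfolding L by (intro tendsto_intros J Q)
    moreover have "\<forall>\<^sub>F w in at \<mu>. - (of_real pi / 2) * bessel_J w x * Q w = ray_integral (2 * w) (2 * x)"
    proof -
      have "\<forall>\<^sub>F w in at \<mu>. w \<notin> \<int>"
        unfolding eventually_at
      proof (intro exI[of _ 1] conjI ballI impI notI)
        fix w assume w: "w \<noteq> \<mu> \<and> dist w \<mu> < 1" "w \<in> \<int>"
        then have "w - \<mu> \<in> \<int>" using True by simp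
        then obtain k where k: "w - \<mu> = of_int k" by (auto elim: Ints_cases)
        have "norm (w - \<mu>) < 1" using w by (simp add: dist_norm)
        then have "\<bar>k\<bar> < 1" unfolding k by simp
        then show False using k w by simp
      qed simp
      then show ?thesis by eventually_elim (use main in auto)
    qed
    ultimately have "(\<lambda>w. ray_integral (2 * w) (2 * x)) \<midarrow>\<mu>\<rightarrow> - (of_real pi / 2) * bessel_J \<mu> x * bessel_Y \<mu> x"
      by (rule Lim_transform_eventually)
    then show ?thesis using F LIM_unique by blast
  qed
qed

section \<open>Change of variables\<close>

lemma Re_csqrt_pos:
  assumes "z \<in> - \<real>\<^sub>\<le>\<^sub>0"
  shows "Re (csqrt z) > 0"
proof (rule ccontr)
  assume "\<not> ?thesis"
  then have "Re (csqrt z) = 0" using csqrt_principal[of z] by auto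
  then have "Re ((csqrt z)\<^sup>2) \<le> 0" "Im ((csqrt z)\<^sup>2) = 0" by (simp_all add: power2_eq_square)
  then show False using assms by (simp add: complex_nonpos_Reals_iff)
qed

lemma Im_eq_csqrt: "Im z = 2 * Re (csqrt z) * Im (csqrt z)"
proof -
  have "Im z = Im ((csqrt z)\<^sup>2)" by simp
  also have "\<dots> = 2 * Re (csqrt z) * Im (csqrt z)" by (simp only: power2_eq_square) simp
  finally show ?thesis .
qed

lemma csqrt_of_real_mult:
  assumes "r > 0"
  shows "csqrt (of_real r * w) = of_real (sqrt r) * csqrt w"
  using assms csqrt_principal[of w]
  by (intro csqrt_unique) (auto simp: power_mult_distrib simp flip: of_real_power)

text \<open>Imaginary parts of equal sign keep the difference of the arguments of \<open>w\<close>
  and \<open>z\<close> strictly between -\<pi> and \<pi>, so no branch is crossed. Algebraically: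
  the product of the two roots has positive real part and is therefore principal.\<close>

lemma csqrt_mult_sgn_cnj:
  assumes z: "z \<in> - \<real>\<^sub>\<le>\<^sub>0" and w: "w \<in> - \<real>\<^sub>\<le>\<^sub>0" and Im: "Im w * Im z \<ge> 0"
  shows "csqrt (w * sgn (cnj z)) = csqrt w * csqrt (sgn (cnj z))"
proof -
  define r s where "r = csqrt z" "s = csqrt w"
  have r: "Re r > 0" and s: "Re s > 0" using Re_csqrt_pos[OF z] Re_csqrt_pos[OF w] by (simp_all add: r_s_def)
  have "z \<noteq> 0" using z by auto
  then have n: "norm z > 0" by simp
  have "(2 * Re s * Im s) * (2 * Re r * Im r) \<ge> 0"
    using Im unfolding Im_eq_csqrt[of z] Im_eq_csqrt[of w] by (simp add: r_s_def)
  then have "(4 * Re s * Re r) * (Im s * Im r) \<ge> 0" by (simp add: mult_ac)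
  moreover have "4 * Re s * Re r > 0" using r s by simp
  ultimately have i: "Im s * Im r \<ge> 0" by (simp add: zero_le_mult_iff)
  \<comment> \<open>Conjugating the root of \<open>z\<close> and normalizing it yields the principal
    root of \<open>sgn (cnj z)\<close>.\<close>
  define d where "d = of_real (1 / sqrt (norm z)) * cnj r"
  have d2: "d\<^sup>2 = sgn (cnj z)"
  proof -
    have "d\<^sup>2 = of_real ((1 / sqrt (norm z))\<^sup>2) * cnj (r\<^sup>2)"
      by (simp only: d_def power_mult_distrib of_real_power complex_cnj_power)
    also have "\<dots> = of_real (1 / norm z) * cnj z" by (simp add: r_s_def power_divide)
    also have "\<dots> = sgn (cnj z)" by (simp add: sgn_eq)
    finally show ?thesis .
  qed
  have "Re d > 0" using r n by (simp add: d_def)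
  then have cd: "csqrt (sgn (cnj z)) = d" by (intro csqrt_unique d2) simp
  have "Re (s * d) = (Re s * Re r + Im s * Im r) / sqrt (norm z)"
    by (simp add: d_def add_divide_distrib)
  moreover have "Re s * Re r + Im s * Im r > 0" using r s i by (simp add: add_pos_nonneg)
  ultimately have "Re (s * d) > 0" using n by simp
  then have "csqrt (w * sgn (cnj z)) = s * d"
    by (intro csqrt_unique) (simp_all add: power_mult_distrib d2 r_s_def)
  then show ?thesis by (simp add: cd r_s_def)
qed

text \<open>As \<open>z * sgn (cnj z) = norm z\<close>, the point \<open>b z\<close> is
  \<open>c + norm z * t\<close>. With \<open>d = sgn (cnj z)\<close>, \<open>b - 2 a\<close> is
  \<open>t * d\<close> and \<open>b + 2 a\<close> is \<open>W * d / norm z\<close>, where Im W has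
  the sign of Im z. Each root therefore splits off \<open>csqrt d\<close>, and their product
  \<open>d\<close> cancels the direction factor of the ray integral.\<close>

lemma ray_kernel_eq_integrand:
  assumes a: "a > 0" and z: "z \<in> - \<real>\<^sub>\<le>\<^sub>0" and t: "t > 0"
  defines "b \<equiv> of_real (2 * a) + of_real t * sgn (cnj z)"
  shows "bessel_J \<nu> (b * z) / sqrt_diff_squares b (of_real (2 * a)) * sgn (cnj z)
    = norm z *\<^sub>R ray_kernel \<nu> (2 * (of_real a * z)) (norm z * t)"
proof -
  define n d where "n = norm z" "d = sgn (cnj z)"
  have z0: "z \<noteq> 0" using z by auto
  then have n: "n > 0" by (simp add: n_d_def)
  have d0: "d \<noteq> 0" using z0 by (simp add: n_d_def sgn_zero_iff)
  have zd: "z * d = of_real n"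
  proof -
    have "z * d = z * cnj z / of_real n" by (simp add: n_d_def sgn_eq)
    also have "z * cnj z = of_real n * of_real n"
      using complex_norm_square[of z] by (simp add: n_d_def power2_eq_square)
    finally show ?thesis using n by simp
  qed
  define W where "W = 2 * (2 * (of_real a * z)) + of_real (n * t)"
  have nt: "n * t > 0" using n t by simp
  have W: "W \<in> - \<real>\<^sub>\<le>\<^sub>0"
    using z a nt by (auto simp: W_def complex_nonpos_Reals_iff zero_less_mult_iff add_pos_pos not_le intro: add_pos_pos)
  have W': "of_real (1 / n) * W \<in> - \<real>\<^sub>\<le>\<^sub>0"
    using W n by (auto simp: complex_nonpos_Reals_iff mult_le_0_iff divide_le_0_iff)
  have Im: "Im (of_real (1 / n) * W) * Im z \<ge> 0"
  proof -
    have e: "Im (of_real (1 / n) * W) * Im z = 4 * a / n * (Im z * Im z)" by (simp add: W_def)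
    show ?thesis unfolding e using a n by simp
  qed
  have bz: "b * z = 2 * (of_real a * z) + of_real (n * t)"
    using zd by (simp add: b_def n_d_def(2)[symmetric] algebra_simps)
  have c1: "csqrt (b - of_real (2 * a)) = of_real (sqrt t) * csqrt d"
    unfolding b_def n_d_def(2) using csqrt_of_real_mult[OF t, of "sgn (cnj z)"] by simp
  have "b + of_real (2 * a) = of_real (1 / n) * W * d"
  proof -
    have "of_real (1 / n) * W * d = of_real (1 / n) * (4 * of_real a * (z * d) + of_real (n * t) * d)"
      by (simp add: W_def algebra_simps)
    also have "\<dots> = b + of_real (2 * a)"
      unfolding zd using n by (simp add: b_def n_d_def(2)[symmetric] algebra_simps)
    finally show ?thesis ..
  qed
  then have c2: "csqrt (b + of_real (2 * a)) = of_real (sqrt (1 / n)) * csqrt W * csqrt d"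
    using csqrt_mult_sgn_cnj[OF z W' Im] csqrt_of_real_mult[of "1 / n" W] n
    by (simp only: n_d_def(2)[symmetric]) simp
  have dd: "csqrt d * csqrt d = d" using power2_csqrt[of d] by (simp add: power2_eq_square)
  have sq: "sqrt (n * t) = n * (sqrt t * sqrt (1 / n))"
  proof -
    define m where "m = sqrt n"
    have m: "m > 0" "n = m * m" using n by (simp_all add: m_def)
    have "sqrt (n * t) = m * sqrt t" "sqrt (1 / n) = 1 / m" by (simp_all add: real_sqrt_mult real_sqrt_divide m_def)
    then show ?thesis using m(1) by (simp add: m(2))
  qed
  have "sqrt_diff_squares b (of_real (2 * a)) = of_real (sqrt t * sqrt (1 / n)) * csqrt W * (csqrt d * csqrt d)"
    unfolding sqrt_diff_squares_def c1 c2 by (simp add: mult_ac)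
  then have S: "sqrt_diff_squares b (of_real (2 * a)) = of_real (sqrt t * sqrt (1 / n)) * csqrt W * d"
    unfolding dd .
  define y where "y = sqrt t * sqrt (1 / n)"
  have y: "y \<noteq> 0" using t n by (simp add: y_def)
  have "bessel_J \<nu> (b * z) / sqrt_diff_squares b (of_real (2 * a)) * d = bessel_J \<nu> (b * z) / (of_real y * csqrt W)"
    unfolding S y_def[symmetric] using d0 by simp
  also have "\<dots> = n *\<^sub>R ray_kernel \<nu> (2 * (of_real a * z)) (n * t)"
    unfolding ray_kernel_def W_def[symmetric] sq y_def[symmetric] bz using n y by (simp add: scaleR_conv_of_real)
  finally show ?thesis by (simp add: n_d_def)
qed

lemma ray_integral_affine:
  assumes c: "c \<in> - \<real>\<^sub>\<le>\<^sub>0" and n: "n > 0"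
  shows "((\<lambda>t. n *\<^sub>R ray_kernel \<nu> c (n * (t - m))) has_integral ray_integral \<nu> c) {m<..}"
proof -
  have im: "(\<lambda>t. n * (t - m)) ` {m<..} = {0<..}"
  proof (intro equalityI subsetI)
    fix s :: real assume "s \<in> {0<..}"
    then have "s = n * ((m + s / n) - m)" "m + s / n \<in> {m<..}" using n by auto
    then show "s \<in> (\<lambda>t. n * (t - m)) ` {m<..}" by blast
  qed (use n in auto)
  have "(\<lambda>t. \<bar>n\<bar> *\<^sub>R ray_kernel \<nu> c (n * (t - m))) absolutely_integrable_on {m<..} \<and>
      integral {m<..} (\<lambda>t. \<bar>n\<bar> *\<^sub>R ray_kernel \<nu> c (n * (t - m))) = ray_integral \<nu> c"
    by (subst has_absolute_integral_change_of_variables_real[where g = "\<lambda>t. n * (t - m)" and h = "\<lambda>_. n" and f = "ray_kernel \<nu> c"])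
       (use n ray_integral_henstock_kurzweil[OF c] in \<open>auto simp: im inj_on_def intro!: derivative_eq_intros\<close>)
  then show ?thesis
    using n by (auto simp: has_integral_iff dest: set_lebesgue_integral_eq_integral(1))
qed

lemma has_integral_Ici_Ioi:
  fixes f :: "real \<Rightarrow> complex"
  shows "(f has_integral I) {m..} \<longleftrightarrow> (f has_integral I) {m<..}"
proof (rule has_integral_spike_set_eq)
  show "negligible {x \<in> {m..} - {m<..}. f x \<noteq> 0}"
    by (rule negligible_subset[of "{m}"]) auto
  have "{x \<in> {m<..} - {m..}. f x \<noteq> 0} = {}" by auto
  then show "negligible {x \<in> {m<..} - {m..}. f x \<noteq> 0}" by (simp only: negligible_empty)
qed

theorem theorem12:
  fixes a \<nu> :: real and z :: complex
  assumes "a > 0" and "\<nu> \<ge> - 1 / 2" and "z \<notin> \<real>\<^sub>\<le>\<^sub>0"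
  shows "(z \<in> \<real> \<longrightarrow>
           ((\<lambda>b::real. bessel_J (of_real \<nu>) (of_real b * z) / of_real (sqrt (b\<^sup>2 - 4 * a\<^sup>2)))
             has_integral
             - (of_real pi / 2) * bessel_J (of_real (\<nu> / 2)) (of_real a * z)
                                * bessel_Y (of_real (\<nu> / 2)) (of_real a * z))
           {2 * a..}) \<and>
         has_ray_integral
           (\<lambda>b. bessel_J (of_real \<nu>) (b * z) / sqrt_diff_squares b (of_real (2 * a)))
           (- (of_real pi / 2) * bessel_J (of_real (\<nu> / 2)) (of_real a * z)
                               * bessel_Y (of_real (\<nu> / 2)) (of_real a * z))
           (of_real (2 * a)) (sgn (cnj z))"
proof
  define I where "I = - (of_real pi / 2) * bessel_J (of_real (\<nu> / 2)) (of_real a * z) * bessel_Y (of_real (\<nu> / 2)) (of_real a * z)"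
  define c where "c = 2 * (of_real a * z)"
  have z: "z \<in> - \<real>\<^sub>\<le>\<^sub>0" using assms(3) by simp
  have az: "of_real a * z \<in> - \<real>\<^sub>\<le>\<^sub>0" and c: "c \<in> - \<real>\<^sub>\<le>\<^sub>0"
    using z assms(1) by (auto simp: c_def complex_nonpos_Reals_iff zero_less_mult_iff mult_le_0_iff)
  have n: "norm z > 0" using z by auto
  \<comment> \<open>The offset \<open>m\<close> serves both conjuncts: 0 for the parameter of the
    ray, \<open>2 * a\<close> for the real variable \<open>b\<close>.\<close>
  have R: "((\<lambda>t. norm z *\<^sub>R ray_kernel (of_real \<nu>) c (norm z * (t - m))) has_integral I) {m<..}" for m
    using ray_integral_affine[OF c n, of "of_real \<nu>" m] ray_integral_eq_bessel_JY[OF az, of "of_real (\<nu> / 2)"]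
    by (simp add: I_def c_def)
  have "((\<lambda>t. bessel_J (of_real \<nu>) ((of_real (2 * a) + of_real t * sgn (cnj z)) * z) /
      sqrt_diff_squares (of_real (2 * a) + of_real t * sgn (cnj z)) (of_real (2 * a)) * sgn (cnj z))
      has_integral I) {0<..}"
  proof (rule has_integral_eq[OF _ R[of 0]])
    fix t :: real assume "t \<in> {0<..}"
    then have "t > 0" by simp
    from ray_kernel_eq_integrand[OF assms(1) z this, of "of_real \<nu>", symmetric]
    show "norm z *\<^sub>R ray_kernel (of_real \<nu>) c (norm z * (t - 0)) =
        bessel_J (of_real \<nu>) ((of_real (2 * a) + of_real t * sgn (cnj z)) * z) /
        sqrt_diff_squares (of_real (2 * a) + of_real t * sgn (cnj z)) (of_real (2 * a)) * sgn (cnj z)"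
      by (simp only: c_def diff_zero)
  qed
  then show "has_ray_integral (\<lambda>b. bessel_J (of_real \<nu>) (b * z) / sqrt_diff_squares b (of_real (2 * a)))
      (- (of_real pi / 2) * bessel_J (of_real (\<nu> / 2)) (of_real a * z) * bessel_Y (of_real (\<nu> / 2)) (of_real a * z))
      (of_real (2 * a)) (sgn (cnj z))"
    unfolding has_ray_integral_def has_integral_Ici_Ioi I_def .
  show "z \<in> \<real> \<longrightarrow>
      ((\<lambda>b::real. bessel_J (of_real \<nu>) (of_real b * z) / of_real (sqrt (b\<^sup>2 - 4 * a\<^sup>2))) has_integral
        - (of_real pi / 2) * bessel_J (of_real (\<nu> / 2)) (of_real a * z) * bessel_Y (of_real (\<nu> / 2)) (of_real a * z)) {2 * a..}"
  proof
    assume "z \<in> \<real>"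
    then obtain r where r: "z = of_real r" by (auto elim: Reals_cases)
    then have "r > 0" using assms(3) by (simp add: complex_nonpos_Reals_iff)
    then have sg: "sgn (cnj z) = 1" by (simp add: r sgn_of_real)
    have "bessel_J (of_real \<nu>) (of_real b * z) / of_real (sqrt (b\<^sup>2 - 4 * a\<^sup>2)) =
        norm z *\<^sub>R ray_kernel (of_real \<nu>) c (norm z * (b - 2 * a))" if b: "b > 2 * a" for b :: real
    proof -
      have "sqrt_diff_squares (of_real b) (of_real (2 * a)) = csqrt (of_real (b - 2 * a)) * csqrt (of_real (b + 2 * a))"
        by (simp add: sqrt_diff_squares_def)
      also have "\<dots> = of_real (sqrt (b - 2 * a)) * of_real (sqrt (b + 2 * a))"
        using b assms(1) by (simp only: csqrt_of_real)
      also have "\<dots> = of_real (sqrt ((b - 2 * a) * (b + 2 * a)))"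
        by (simp add: real_sqrt_mult)
      also have "(b - 2 * a) * (b + 2 * a) = b\<^sup>2 - 4 * a\<^sup>2"
        by (simp add: power2_eq_square algebra_simps)
      finally have d: "sqrt_diff_squares (of_real b) (of_real (2 * a)) = of_real (sqrt (b\<^sup>2 - 4 * a\<^sup>2))" .
      have "of_real (2 * a) + of_real (b - 2 * a) * sgn (cnj z) = of_real b" by (simp add: sg)
      then show ?thesis
        using ray_kernel_eq_integrand[OF assms(1) z, of "b - 2 * a" "of_real \<nu>"] b d by (simp only: sg c_def mult_1_right)
    qed
    then have "((\<lambda>b::real. bessel_J (of_real \<nu>) (of_real b * z) / of_real (sqrt (b\<^sup>2 - 4 * a\<^sup>2))) has_integral I) {2 * a<..}"
      by (intro has_integral_eq[OF _ R[of "2 * a"]]) simp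
    then show "((\<lambda>b::real. bessel_J (of_real \<nu>) (of_real b * z) / of_real (sqrt (b\<^sup>2 - 4 * a\<^sup>2))) has_integral
        - (of_real pi / 2) * bessel_J (of_real (\<nu> / 2)) (of_real a * z) * bessel_Y (of_real (\<nu> / 2)) (of_real a * z)) {2 * a..}"
      unfolding has_integral_Ici_Ioi I_def .
  qed
qed

end
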